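(* Let $G$ be a finitely generated subgroup of $\mathrm{Diff}^2_+(S^1)$ satisfying property $(\star)$. Then the following hold: (1) The set $\mathrm{NE}(G)$ of non-expandable points is finite. (2) For every point $x\in S^1$, either the set of derivatives $\{g'(x)\mid g\in G\}$ is unbounded, or $x$ belongs to the $G$-orbit of some non-expandable point. (3) The action of $G$ on $S^1$ is ergodic with respect to the Lebesgue measure.
   Context: $\mathrm{Diff}^2_+(S^1)$ is the group of orientation-preserving $C^2$ diffeomorphisms of the circle $S^1$. A Riemannian metric on $S^1$ is fixed and $g'(x)>0$ denotes the derivative of $g$ at $x$ with respect to this metric. The action of $G$ is minimal if every orbit is dense. A point $x\in S^1$ is non-expandable if $g'(x)\le 1$ for all $g\in G$; $\mathrm{NE}(G)$ is the set of all non-expandable points. Property $(\star)$: $G$ acts minimally on $S^1$, and for every $x\in \mathrm{NE}(G)$ there exist $g_+,g_-\in G$ such that $g_+(x)=g_-(x)=x$ and, for some $\varepsilon>0$, $g_+$ has no other fixed point in $(x,x+\varepsilon)$ and $g_-$ has no other fixed point in $(x-\varepsilon,x)$. Ergodicity with respect to Lebesgue: every $G$-invariant Lebesgue-measurable subset $A\subset S^1$ has either zero Lebesgue measure or a complement of zero Lebesgue measure. *)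

theory Defs
  imports "HOL-Analysis.Analysis" "HOL-Algebra.Bij" "HOL-Algebra.Generated_Groups"
begin

abbreviation circle :: "complex set" where
  "circle \<equiv> sphere 0 1"

text \<open>
  Since \<open>cis\<close> is a local diffeomorphism from the line onto the unit circle, a function on the
  circle is smooth, or of class $C^2$, if and only if its composition with \<open>cis\<close> is. A map into
  the circle is of class $C^2$ if and only if it is so as a map into the complex plane.
\<close>

definition C2_circle_map :: "(complex \<Rightarrow> complex) \<Rightarrow> bool" where
  "C2_circle_map g \<longleftrightarrow> g ` circle \<subseteq> circle \<and>
     (\<exists>D. (\<forall>t. ((\<lambda>s. g (cis s)) has_vector_derivative D t) (at t)) \<and> D C1_differentiable_on UNIV)"

text \<open>
  The tangent line at \<open>x\<close> is spanned by the unit vector \<open>\<i> * x\<close>. The following is the coefficient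
  of the differential of \<open>g\<close> at \<open>x\<close> with respect to \<open>\<i> * x\<close> and \<open>\<i> * g x\<close>; the quotient is real
  when \<open>g\<close> maps the circle to itself and is differentiable at \<open>x\<close>.
\<close>

definition angular_deriv :: "(complex \<Rightarrow> complex) \<Rightarrow> complex \<Rightarrow> real" where
  "angular_deriv g x = Re (vector_derivative (\<lambda>t. g (x * cis t)) (at 0) / (\<i> * g x))"

text \<open>Elements of \<^term>\<open>Bij circle\<close> are extensional, i.e. \<^const>\<open>undefined\<close> off the circle.\<close>

definition Diff2_plus :: "(complex \<Rightarrow> complex) set" where
  "Diff2_plus = {g \<in> Bij circle. C2_circle_map g \<and> C2_circle_map (inv_into circle g) \<and>
     (\<forall>x\<in>circle. 0 < angular_deriv g x)}"

text \<open>
  A Riemannian metric on the circle is determined by its coefficient \<open>h x\<close>, the squared length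
  of the tangent vector \<open>\<i> * x\<close>.
\<close>

definition riemannian_metric :: "(complex \<Rightarrow> real) \<Rightarrow> bool" where
  "riemannian_metric h \<longleftrightarrow> (\<forall>x\<in>circle. 0 < h x) \<and>
     (\<forall>n. ((deriv ^^ n) (\<lambda>t::real. h (cis t))) differentiable_on UNIV)"

text \<open>The derivative \<open>g'(x)\<close> relative to positively oriented \<open>h\<close>-unit tangent vectors.\<close>

definition metric_deriv :: "(complex \<Rightarrow> real) \<Rightarrow> (complex \<Rightarrow> complex) \<Rightarrow> complex \<Rightarrow> real" where
  "metric_deriv h g x = angular_deriv g x * sqrt (h (g x)) / sqrt (h x)"

definition finitely_generated_in :: "('a, 'b) monoid_scheme \<Rightarrow> 'a set \<Rightarrow> bool" where
  "finitely_generated_in M G \<longleftrightarrow> (\<exists>S. finite S \<and> S \<subseteq> G \<and> G = generate M S)"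

definition orbit_of :: "(complex \<Rightarrow> complex) set \<Rightarrow> complex \<Rightarrow> complex set" where
  "orbit_of G x = (\<lambda>g. g x) ` G"

definition minimal_action :: "(complex \<Rightarrow> complex) set \<Rightarrow> bool" where
  "minimal_action G \<longleftrightarrow> (\<forall>x\<in>circle. circle \<subseteq> closure (orbit_of G x))"

definition NE :: "(complex \<Rightarrow> real) \<Rightarrow> (complex \<Rightarrow> complex) set \<Rightarrow> complex set" where
  "NE h G = {x \<in> circle. \<forall>g\<in>G. metric_deriv h g x \<le> 1}"

text \<open>The arc \<open>(x, x + \<epsilon>)\<close> of the circle consists of the points \<open>x * cis t\<close> with \<open>0 < t < \<epsilon>\<close>.\<close>

definition property_star :: "(complex \<Rightarrow> real) \<Rightarrow> (complex \<Rightarrow> complex) set \<Rightarrow> bool" where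
  "property_star h G \<longleftrightarrow> minimal_action G \<and>
     (\<forall>x\<in>NE h G. \<exists>gp\<in>G. \<exists>gm\<in>G. gp x = x \<and> gm x = x \<and>
        (\<exists>\<epsilon>>0. (\<forall>t\<in>{0<..<\<epsilon>}. gp (x * cis t) \<noteq> x * cis t) \<and>
               (\<forall>t\<in>{-\<epsilon><..<0}. gm (x * cis t) \<noteq> x * cis t)))"

definition circle_lebesgue :: "complex measure" where
  "circle_lebesgue =
     completion (distr (restrict_space lborel {0..<2 * pi}) (restrict_space borel circle) cis)"

definition lebesgue_ergodic :: "(complex \<Rightarrow> complex) set \<Rightarrow> bool" where
  "lebesgue_ergodic G \<longleftrightarrow>
     (\<forall>A\<in>sets circle_lebesgue. (\<forall>g\<in>G. g ` A = A) \<longrightarrow>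
        emeasure circle_lebesgue A = 0 \<or> emeasure circle_lebesgue (circle - A) = 0)"

end

theory Submission
  imports Defs
begin

text \<open>
  Lifting the action to the line turns $G$ into a group of diffeomorphisms with Lipschitz logarithmic
  derivatives.  Near a non-expandable point $y$, a map fixing $y$ with no further fixed point on one
  side expands by arbitrarily large factors under iteration, and since the successive images of a
  fundamental interval are disjoint, the distortion of the iterates is controlled by their final
  derivative.  Hence non-expandable points are isolated, and by compactness every other point admits
  a group element that expands by a uniform factor $\mu > 1$ with uniformly controlled distortion.  A
  point whose orbit avoids the non-expandable points can be expanded again and again; the intermediate
  derivatives grow geometrically, so the total distortion is governed by the last of them.  Such
  a point therefore has arbitrarily small neighbourhoods that are mapped with bounded distortion
  onto intervals of definite size.  By minimality an invariant set of positive measure has a definite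
  share of these intervals, hence of the small neighbourhoods, and a Vitali covering argument
  shows that its complement is null.
\<close>

section \<open>Distortion of diffeomorphisms of the line\<close>

text \<open>The obstacle is that no finite set of maps expands by a uniform factor around a
  non-expandable point: a map fixing that point has derivative 1 there, so the number of iterates
  needed to gain a definite factor is unbounded nearby, and so are their second derivatives. What
  stays bounded is the ratio of the distortion to the derivative attained. This ratio also survives
  composition: a further expanding map adds a fixed multiple of the new derivative, while the old
  term is at most a 1/\<mu> share of the new one. Two derivatives occur: the metric one decides
  which points are expandable, the one in the angle coordinate enters the distortion estimates, and
  compactness of the circle makes them comparable. Finite generation enters through countability of
  the group.\<close>

definition increasing_diff :: "(real \<Rightarrow> real) \<Rightarrow> bool" where
  "increasing_diff F \<longleftrightarrow> (\<forall>t. \<exists>d>0. (F has_real_derivative d) (at t))"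

lemma increasing_diffD:
  assumes "increasing_diff F"
  shows "(F has_real_derivative deriv F t) (at t)" "0 < deriv F t"
  using assms unfolding increasing_diff_def by (metis DERIV_imp_deriv)+

lemma increasing_diff_comp:
  assumes "increasing_diff F" "increasing_diff G"
  shows "increasing_diff (F \<circ> G)" "deriv (F \<circ> G) t = deriv F (G t) * deriv G t"
proof -
  have *: "((F \<circ> G) has_real_derivative deriv F (G t) * deriv G t) (at t)" for t
    using assms by (intro DERIV_chain increasing_diffD)
  show "deriv (F \<circ> G) t = deriv F (G t) * deriv G t"
    by (rule DERIV_imp_deriv[OF *])
  show "increasing_diff (F \<circ> G)"
    unfolding increasing_diff_def
    using * assms[THEN increasing_diffD(2)] by (meson mult_pos_pos)
qed

lemma ln_deriv_comp:
  assumes "increasing_diff F" "increasing_diff G"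
  shows "ln (deriv (F \<circ> G) t) = ln (deriv F (G t)) + ln (deriv G t)"
  unfolding increasing_diff_comp(2)[OF assms]
  using assms increasing_diffD(2) by (intro ln_mult_pos) auto

lemma increasing_diff_id: "increasing_diff id"
  unfolding increasing_diff_def by (auto intro!: exI[of _ 1] derivative_eq_intros simp: id_def)

lemma increasing_diff_funpow: "increasing_diff f \<Longrightarrow> increasing_diff (f ^^ n)"
  by (induction n) (auto intro: increasing_diff_comp increasing_diff_id)

lemma increasing_diff_strict_mono:
  assumes "increasing_diff F" shows "strict_mono F"
  by (rule strict_monoI, rule DERIV_pos_imp_increasing) (use assms increasing_diffD in blast)+

lemma increasing_diff_continuous:
  assumes "increasing_diff F" shows "continuous_on S F"
  by (meson DERIV_continuous_on assms has_field_derivative_at_within increasing_diffD(1))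

lemma increasing_diff_mvt:
  assumes "increasing_diff F"
  obtains v where "min x u \<le> v" "v \<le> max x u" "F u - F x = (u - x) * deriv F v"
proof (cases u x rule: linorder_cases)
  case less
  from MVT2[OF this increasing_diffD(1)[OF assms]] obtain v
    where "u < v" "v < x" "F x - F u = (x - u) * deriv F v" by blast
  with less show ?thesis by (intro that[of v]) (auto simp: algebra_simps)
next
  case equal
  then show ?thesis by (intro that[of x]) auto
next
  case greater
  from MVT2[OF this increasing_diffD(1)[OF assms]] obtain v
    where "x < v" "v < u" "F u - F x = (u - x) * deriv F v" by blast
  with greater show ?thesis by (intro that[of v]) auto
qed

text \<open>The number \<open>S\<close> plays the role of the sum of the intermediate derivatives at \<open>x\<close>, so that \<open>1 / S\<close>
  is the radius on which \<open>F\<close> is almost affine.\<close>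

definition distortion_le :: "(real \<Rightarrow> real) \<Rightarrow> real \<Rightarrow> real \<Rightarrow> bool" where
  "distortion_le F x S \<longleftrightarrow> 0 \<le> S \<and>
     (\<forall>u. S * \<bar>u - x\<bar> \<le> 1 \<longrightarrow> \<bar>ln (deriv F u) - ln (deriv F x)\<bar> \<le> S * \<bar>u - x\<bar>)"

lemma distortion_le_mono:
  assumes "distortion_le F x S" "S \<le> T"
  shows "distortion_le F x T"
proof -
  have "S * \<bar>u - x\<bar> \<le> T * \<bar>u - x\<bar>" for u
    using assms(2) by (simp add: mult_right_mono)
  then show ?thesis
    using assms unfolding distortion_le_def by (meson order_trans)
qed

lemma distortion_le_lipschitz:
  assumes "0 \<le> q" "\<And>s t. \<bar>ln (deriv f s) - ln (deriv f t)\<bar> \<le> q * \<bar>s - t\<bar>"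
  shows "distortion_le f x q"
  using assms unfolding distortion_le_def by blast

lemma ln_diff_le_imp_bounds:
  assumes "\<bar>ln a - ln b\<bar> \<le> c" "0 < a" "0 < b"
  shows "exp (- c) * b \<le> a" "a \<le> exp c * (b :: real)"
proof -
  have "exp (ln b - c) \<le> exp (ln a)" "exp (ln a) \<le> exp (ln b + c)"
    using assms(1) unfolding exp_le_cancel_iff by linarith+
  then show "exp (- c) * b \<le> a" "a \<le> exp c * b"
    using assms(2,3) by (simp_all add: exp_diff exp_add exp_minus field_simps)
qed

lemma distortion_le_deriv:
  assumes "increasing_diff F" "distortion_le F x S" "S * \<bar>u - x\<bar> \<le> 1"
  shows "exp (- 1) * deriv F x \<le> deriv F u" "deriv F u \<le> exp 1 * deriv F x"
proof -
  have "\<bar>ln (deriv F u) - ln (deriv F x)\<bar> \<le> 1"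
    using assms(2,3) unfolding distortion_le_def by force
  from ln_diff_le_imp_bounds[OF this increasing_diffD(2,2)[OF assms(1)]] show
    "exp (- 1) * deriv F x \<le> deriv F u" "deriv F u \<le> exp 1 * deriv F x" .
qed

text \<open>The mean value point lies between \<open>x\<close> and \<open>u\<close>, hence in the
  same window, where all derivatives agree with \<open>deriv F x\<close> up to a factor e.\<close>

lemma distortion_le_dist:
  assumes "increasing_diff F" "distortion_le F x S" "S * \<bar>u - x\<bar> \<le> 1"
  shows "exp (- 1) * deriv F x * \<bar>u - x\<bar> \<le> \<bar>F u - F x\<bar>"
    and "\<bar>F u - F x\<bar> \<le> exp 1 * deriv F x * \<bar>u - x\<bar>"
proof -
  obtain v where v: "min x u \<le> v" "v \<le> max x u" "F u - F x = (u - x) * deriv F v"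
    using increasing_diff_mvt[OF assms(1)] by blast
  have "\<bar>v - x\<bar> \<le> \<bar>u - x\<bar>" using v(1,2) by (auto simp: min_def max_def split: if_splits)
  then have "S * \<bar>v - x\<bar> \<le> 1"
    using assms(2,3) unfolding distortion_le_def by (meson mult_left_mono order_trans)
  note b = distortion_le_deriv[OF assms(1,2) this]
  have "\<bar>F u - F x\<bar> = deriv F v * \<bar>u - x\<bar>"
    using v(3) increasing_diffD(2)[OF assms(1), of v] by (simp add: abs_mult)
  then show "exp (- 1) * deriv F x * \<bar>u - x\<bar> \<le> \<bar>F u - F x\<bar>"
    and "\<bar>F u - F x\<bar> \<le> exp 1 * deriv F x * \<bar>u - x\<bar>"
    using b by (simp_all only: mult_right_mono abs_ge_zero)
qed

text \<open>Within the window \<open>F\<close> stretches distances from \<open>x\<close> by at most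
  e times \<open>deriv F x\<close>. Hence \<open>F u\<close> stays in the window of \<open>H\<close>
  at \<open>F x\<close>, and a distortion \<open>T\<close> there costs
  \<open>exp 1 * T * deriv F x\<close> when measured at \<open>x\<close>.\<close>

lemma distortion_le_comp:
  assumes F: "increasing_diff F" "distortion_le F x S"
    and H: "increasing_diff H" "distortion_le H (F x) T"
  shows "distortion_le (H \<circ> F) x (S + exp 1 * T * deriv F x)"
proof -
  let ?c = "exp 1 * T * deriv F x"
  have T: "0 \<le> T" and S: "0 \<le> S" using F H by (auto simp: distortion_le_def)
  have F': "0 < deriv F u" and H': "0 < deriv H u" for u
    using F(1) H(1) increasing_diffD by auto
  have c: "0 \<le> ?c" using T F' by (simp add: less_imp_le)
  moreover have "\<bar>ln (deriv (H \<circ> F) u) - ln (deriv (H \<circ> F) x)\<bar> \<le> (S + ?c) * \<bar>u - x\<bar>"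
    if u: "(S + ?c) * \<bar>u - x\<bar> \<le> 1" for u
  proof -
    have uS: "S * \<bar>u - x\<bar> \<le> 1" and uc: "?c * \<bar>u - x\<bar> \<le> 1"
      using u S c by (auto simp: distrib_right intro: order_trans[rotated])
    have "\<bar>F u - F x\<bar> \<le> exp 1 * deriv F x * \<bar>u - x\<bar>"
      by (rule distortion_le_dist[OF F uS])
    then have *: "T * \<bar>F u - F x\<bar> \<le> ?c * \<bar>u - x\<bar>"
      using mult_left_mono[OF _ T] by (fastforce simp: mult_ac)
    then have "\<bar>ln (deriv H (F u)) - ln (deriv H (F x))\<bar> \<le> ?c * \<bar>u - x\<bar>"
      using H(2) uc unfolding distortion_le_def by (meson order_trans)
    moreover have "\<bar>ln (deriv F u) - ln (deriv F x)\<bar> \<le> S * \<bar>u - x\<bar>"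
      using F(2) uS unfolding distortion_le_def by blast
    ultimately show ?thesis
      by (simp add: ln_deriv_comp[OF H(1) F(1)] distrib_right)
  qed
  ultimately show ?thesis using S unfolding distortion_le_def by auto
qed

section \<open>Iteration near a fixed point that repels on one side\<close>

lemma pos_gap_compact:
  fixes f :: "real \<Rightarrow> real"
  assumes "continuous_on {c..d} f" "\<And>t. t \<in> {c..d} \<Longrightarrow> t < f t"
  obtains m where "m > 0" "\<And>t. t \<in> {c..d} \<Longrightarrow> t + m \<le> f t"
proof (cases "{c..d} = {}")
  case True
  then show ?thesis using that[of 1] by auto
next
  case False
  have "continuous_on {c..d} (\<lambda>t. f t - t)" using assms(1) by (intro continuous_intros)
  from continuous_attains_inf[OF compact_Icc False this]
  obtain x where x: "x \<in> {c..d}" "\<forall>y\<in>{c..d}. f x - x \<le> f y - y" by blast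
  show ?thesis
    by (rule that[of "f x - x"]) (use x assms(2) in \<open>fastforce+\<close>)
qed

lemma funpow_escapes:
  fixes f :: "real \<Rightarrow> real"
  assumes "continuous_on {z..a} f" "\<And>t. t \<in> {z..a} \<Longrightarrow> t < f t"
  shows "\<exists>n. a < (f ^^ n) z"
proof (rule ccontr)
  assume "\<not> ?thesis"
  then have le: "(f ^^ n) z \<le> a" for n by (simp add: not_less)
  obtain m where m: "m > 0" "\<And>t. t \<in> {z..a} \<Longrightarrow> t + m \<le> f t"
    using pos_gap_compact[OF assms] by blast
  have *: "z + real n * m \<le> (f ^^ n) z" for n
  proof (induction n)
    case (Suc n)
    then have "(f ^^ n) z \<in> {z..a}"
      using le[of n] m(1) by (auto intro: order_trans[rotated])
    with m(2) Suc show ?case by (force simp: algebra_simps)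
  qed simp
  obtain n where "a - z < real n * m"
    using m(1) reals_Archimedean3 by blast
  with *[of n] le[of n] show False by linarith
qed

text \<open>A non-expandable fixed point has derivative 1, so linearisation at \<open>y\<close>
  gives nothing. Growth is read off from lengths: the first step of the orbit shrinks to 0 as
  \<open>z\<close> approaches \<open>y\<close>, while the step taken after passing a fixed point
  \<open>a\<close> has length at least \<open>m\<close>. The constant \<open>C\<close> is chosen
  before \<open>M\<close>.\<close>

lemma repelling_fixed_point:
  assumes f: "increasing_diff f" and q: "0 \<le> q"
    and lip: "\<And>s t. \<bar>ln (deriv f s) - ln (deriv f t)\<bar> \<le> q * \<bar>s - t\<bar>"
    and y: "f y = y" and \<epsilon>: "0 < \<epsilon>" and up: "\<And>t. y < t \<Longrightarrow> t < y + \<epsilon> \<Longrightarrow> t < f t"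
  obtains C where "0 \<le> C" "\<And>M. \<exists>\<delta>>0. \<forall>z. y < z \<and> z < y + \<delta> \<longrightarrow>
      (\<exists>n. distortion_le (f ^^ n) z (C * deriv (f ^^ n) z) \<and> M \<le> deriv (f ^^ n) z)"
proof -
  have fp: "increasing_diff (f ^^ k)" for k
    using f by (rule increasing_diff_funpow)
  have mono: "strict_mono (f ^^ k)" for k
    using fp by (rule increasing_diff_strict_mono)
  have f_mono: "strict_mono f" using f by (rule increasing_diff_strict_mono)
  have fpos: "0 < deriv (f ^^ k) t" for k t using fp increasing_diffD by blast
  have cont: "continuous_on S f" for S using f by (rule increasing_diff_continuous)
  then have tend: "f \<midarrow>y\<rightarrow> y"
    using y by (metis UNIV_I continuous_on_def at_within_open open_UNIV)
  \<comment> \<open>The points satisfy \<open>y < a < b < y + \<epsilon>\<close> and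
    \<open>f a \<le> b\<close>, so a step from below \<open>a\<close> cannot jump over
    \<open>[a, b]\<close>, where \<open>f\<close> advances by at least \<open>m\<close>.\<close>
  define b where "b = y + \<epsilon> / 2"
  obtain d where d: "d > 0" "\<And>t. t \<noteq> y \<Longrightarrow> \<bar>t - y\<bar> < d \<Longrightarrow> \<bar>f t - y\<bar> < \<epsilon> / 2"
    using LIM_D[OF tend, of "\<epsilon> / 2"] \<epsilon> by auto
  define a where "a = y + min d (\<epsilon> / 2) / 2"
  have a: "y < a" "a < b" "a - y < d"
    using d(1) \<epsilon> by (auto simp: a_def b_def min_def)
  then have "f a \<le> b" using d(2)[of a] by (simp add: b_def abs_if split: if_splits)
  note a = a(1,2) this
  have b: "b < y + \<epsilon>" using \<epsilon> by (simp add: b_def)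
  obtain m where m: "m > 0" "\<And>t. t \<in> {a..b} \<Longrightarrow> t + m \<le> f t"
    by (rule pos_gap_compact[OF cont, of a b]) (use up a b in auto)
  \<comment> \<open>The log-distortion is at most \<open>q\<close> times the length of the orbit
    segment, which is at most \<open>\<epsilon>\<close>.\<close>
  define K where "K = exp (q * \<epsilon>)"
  have K: "1 \<le> K" using q \<epsilon> by (simp add: K_def)
  \<comment> \<open>The factor \<open>exp 1 * q\<close> is the cost of one application of
    \<open>f\<close> in \<open>distortion_le_comp\<close>; \<open>K\<^sup>2 * \<epsilon> / m\<close>
    comes from combining \<open>s1\<close> and \<open>s2\<close>.\<close>
  define C where "C = exp 1 * q * K\<^sup>2 * \<epsilon> / m"
  \<comment> \<open>The orbit of \<open>z\<close> is followed until it first passes \<open>a\<close>. The intervals \<open>[w k, w (k + 1)]\<close> do not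
    overlap, so their lengths, which are comparable to the derivatives of the iterates at \<open>z\<close>, have
    bounded sum, while the last of them has length at least \<open>m\<close>.\<close>
  show ?thesis
  proof (rule that[of C])
    show "0 \<le> C" using q \<epsilon> m K by (auto simp: C_def)
    fix M
    have "((\<lambda>t. f t - t) \<longlongrightarrow> y - y) (at y)" by (intro tendsto_intros tend)
    \<comment> \<open>With an initial step shorter than this, \<open>s2\<close> forces the final
      derivative above \<open>\<bar>M\<bar> + 1\<close>; the added 1 keeps the denominator
      positive.\<close>
    moreover have p: "0 < m / (K * (\<bar>M\<bar> + 1))" using m K by auto
    ultimately obtain d' where d': "d' > 0"
      "\<And>t. t \<noteq> y \<Longrightarrow> \<bar>t - y\<bar> < d' \<Longrightarrow> \<bar>f t - t\<bar> < m / (K * (\<bar>M\<bar> + 1))"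
      using LIM_D[of _ _ y, OF _ p] by force
    have "\<exists>n. distortion_le (f ^^ n) z (C * deriv (f ^^ n) z) \<and> M \<le> deriv (f ^^ n) z"
      if z: "y < z" "z < y + min d' (a - y)" for z
    proof -
      define w where "w k = (f ^^ k) z" for k
      have w0: "w 0 = z" and wS: "w (Suc k) = f (w k)" and wS': "w (Suc k) = (f ^^ k) (w 1)" for k
        by (simp_all add: w_def funpow_swap1)
      have za: "z < a" using z by auto
      have w01: "w 0 < w 1" using up[of z] z za a b by (simp add: w_def)
      have wmono: "w k < w (Suc k)" for k
        using mono[of k] w01 unfolding wS' by (auto simp: w_def strict_mono_def)
      have "\<exists>n. a < w n"
        unfolding w_def by (rule funpow_escapes[OF cont]) (use up z a b in auto)
      \<comment> \<open>Minimality of \<open>n\<close> gives \<open>w n \<le> f a \<le> b\<close>,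
        so the gap \<open>m\<close> is still available at \<open>w n\<close>.\<close>
      define n where "n = (LEAST n. a < w n)"
      have wn: "a < w n" unfolding n_def by (rule LeastI_ex) fact
      have "n \<noteq> 0" using wn za w0 by (metis less_asym)
      then obtain n' where n': "n = Suc n'" using not0_implies_Suc by blast
      have "w n' \<le> a" using not_less_Least[of n' "\<lambda>n. a < w n"] n' unfolding n_def by auto
      then have "w n \<le> f a"
        using f_mono by (simp add: n' wS strict_mono_less_eq)
      then have wnb: "w n \<le> b" using a by simp
      have wle: "w k \<le> w l" if "k \<le> l" for k l
        using wmono that by (simp add: lift_Suc_mono_le less_imp_le)
      \<comment> \<open>The \<open>j\<close>-th image of \<open>u\<close> lies between
        \<open>w j\<close> and \<open>w (Suc j)\<close>, so the \<open>j\<close>-th factor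
        contributes at most \<open>q\<close> times that length, and the lengths telescope.\<close>
      have dist: "\<bar>ln (deriv (f ^^ k) u) - ln (deriv (f ^^ k) z)\<bar> \<le> q * (w k - w 0)"
        if u: "w 0 \<le> u" "u \<le> w 1" for u k
      proof (induction k)
        case (Suc k)
        have "w k \<le> (f ^^ k) u" "(f ^^ k) u \<le> w (Suc k)"
          using u mono[of k] unfolding wS' by (simp_all add: w_def strict_mono_less_eq)
        then have "\<bar>(f ^^ k) u - w k\<bar> \<le> w (Suc k) - w k" by simp
        then have "q * \<bar>(f ^^ k) u - w k\<bar> \<le> q * (w (Suc k) - w k)"
          using q by (rule mult_left_mono)
        with lip[of "(f ^^ k) u" "w k"]
        have "\<bar>ln (deriv f ((f ^^ k) u)) - ln (deriv f (w k))\<bar> \<le> q * (w (Suc k) - w k)"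
          by simp
        with Suc show ?case
          unfolding funpow.simps ln_deriv_comp[OF f fp]
          by (simp add: w_def[symmetric] algebra_simps)
      qed simp
      \<comment> \<open>Only \<open>w k\<close> enters the distortion bound, so the case
        \<open>k = n\<close> is covered although \<open>w (Suc n)\<close> may lie beyond
        \<open>b\<close>.\<close>
      have comp: "deriv (f ^^ k) z * (w 1 - w 0) \<le> K * (w (Suc k) - w k)"
                 "w (Suc k) - w k \<le> K * (deriv (f ^^ k) z * (w 1 - w 0))" if "k \<le> n" for k
      proof -
        obtain v where v: "w 0 \<le> v" "v \<le> w 1" "w (Suc k) - w k = (w 1 - w 0) * deriv (f ^^ k) v"
        proof -
          have "(f ^^ k) (w 0) = w k" by (simp add: w_def)
          then show ?thesis
            using increasing_diff_mvt[OF fp[of k], of "w 0" "w 1"] w01 that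
            unfolding wS' by (metis less_imp_le max_absorb2 min_absorb1)
        qed
        have "w k - w 0 \<le> \<epsilon>"
          using wle[OF that] wnb w0 b z by linarith
        then have "q * (w k - w 0) \<le> q * \<epsilon>" using q by (rule mult_left_mono)
        then have "\<bar>ln (deriv (f ^^ k) v) - ln (deriv (f ^^ k) z)\<bar> \<le> q * \<epsilon>"
          using dist[OF v(1,2), of k] by linarith
        from ln_diff_le_imp_bounds[OF this fpos fpos]
        have *: "deriv (f ^^ k) z \<le> K * deriv (f ^^ k) v" "deriv (f ^^ k) v \<le> K * deriv (f ^^ k) z"
          by (auto simp: K_def exp_minus field_simps)
        have w: "0 \<le> w 1 - w 0" using w01 by simp
        show "deriv (f ^^ k) z * (w 1 - w 0) \<le> K * (w (Suc k) - w k)"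
             "w (Suc k) - w k \<le> K * (deriv (f ^^ k) z * (w 1 - w 0))"
          using *[THEN mult_right_mono, OF w] by (simp_all add: v(3) mult_ac)
      qed
      have sumdist: "distortion_le (f ^^ k) z (exp 1 * q * (\<Sum>j<k. deriv (f ^^ j) z))" for k
      proof (induction k)
        case 0
        then show ?case by (simp add: distortion_le_def)
      next
        case (Suc k)
        show ?case
          unfolding funpow.simps
          using distortion_le_comp[OF fp Suc f distortion_le_lipschitz[OF q lip]]
          by (simp add: algebra_simps del: o_apply)
      qed
      have "(\<Sum>j<n. deriv (f ^^ j) z) * (w 1 - w 0) \<le> (\<Sum>j<n. K * (w (Suc j) - w j))"
        unfolding sum_distrib_right by (rule sum_mono) (use comp in auto)
      also have "\<dots> = K * (w n - w 0)"
        by (simp add: sum_distrib_left[symmetric] sum_lessThan_telescope)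
      also have "\<dots> \<le> K * \<epsilon>"
        using wnb b z K w0 by (intro mult_left_mono) auto
      finally have s1: "(\<Sum>j<n. deriv (f ^^ j) z) * (w 1 - w 0) \<le> K * \<epsilon>" .
      have "m \<le> w (Suc n) - w n" using m(2)[of "w n"] wn wnb wS[of n] by simp
      also have "\<dots> \<le> K * (deriv (f ^^ n) z * (w 1 - w 0))" by (rule comp) simp
      finally have s2: "m \<le> K * (deriv (f ^^ n) z * (w 1 - w 0))" .
      \<comment> \<open>Multiplying \<open>s1\<close> by \<open>s2\<close> lets the initial step
        \<open>w 1 - w 0\<close> cancel.\<close>
      have "(\<Sum>j<n. deriv (f ^^ j) z) * (w 1 - w 0) * m \<le> K * \<epsilon> * (K * (deriv (f ^^ n) z * (w 1 - w 0)))"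
        by (rule mult_mono[OF s1 s2]) (use m(1) K \<epsilon> in auto)
      then have "((\<Sum>j<n. deriv (f ^^ j) z) * m) * (w 1 - w 0) \<le> (K\<^sup>2 * \<epsilon> * deriv (f ^^ n) z) * (w 1 - w 0)"
        by (simp add: power2_eq_square mult_ac)
      then have "(\<Sum>j<n. deriv (f ^^ j) z) * m \<le> K\<^sup>2 * \<epsilon> * deriv (f ^^ n) z"
        using w01 by simp
      then have "(\<Sum>j<n. deriv (f ^^ j) z) \<le> K\<^sup>2 * \<epsilon> / m * deriv (f ^^ n) z"
        using m(1) by (simp add: field_simps)
      then have "exp 1 * q * (\<Sum>j<n. deriv (f ^^ j) z) \<le> exp 1 * q * (K\<^sup>2 * \<epsilon> / m * deriv (f ^^ n) z)"
        using q by (intro mult_left_mono) auto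
      then have "exp 1 * q * (\<Sum>j<n. deriv (f ^^ j) z) \<le> C * deriv (f ^^ n) z"
        by (simp add: C_def mult_ac)
      then have 1: "distortion_le (f ^^ n) z (C * deriv (f ^^ n) z)"
        by (rule distortion_le_mono[OF sumdist])
      have "w 1 - w 0 < m / (K * (\<bar>M\<bar> + 1))"
        using d'(2)[of z] z w01 by (simp add: w_def)
      moreover have "0 < K * (\<bar>M\<bar> + 1)" using K by simp
      ultimately have "K * (\<bar>M\<bar> + 1) * (w 1 - w 0) < m"
        by (metis pos_less_divide_eq mult.commute)
      also note s2
      finally have "(\<bar>M\<bar> + 1) * (K * (w 1 - w 0)) < deriv (f ^^ n) z * (K * (w 1 - w 0))"
        by (simp add: mult_ac)
      then have "\<bar>M\<bar> + 1 < deriv (f ^^ n) z"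
        using K w01 by (simp add: mult_less_cancel_right)
      with 1 show ?thesis by (intro exI[of _ n]) auto
    qed
    then show "\<exists>\<delta>>0. \<forall>z. y < z \<and> z < y + \<delta> \<longrightarrow>
      (\<exists>n. distortion_le (f ^^ n) z (C * deriv (f ^^ n) z) \<and> M \<le> deriv (f ^^ n) z)"
      using d'(1) a by (intro exI[of _ "min d' (a - y)"]) auto
  qed
qed

section \<open>Uniform expansion away from the non-expandable points\<close>

text \<open>Conjugation by the reflection of the line exchanges the two sides of a fixed point and
  preserves derivatives, so it transfers the one-sided estimates.\<close>

lemma increasing_diff_reflect:
  assumes "increasing_diff f"
  shows "increasing_diff (\<lambda>t. - f (- t))" "deriv (\<lambda>t. - f (- t)) t = deriv f (- t)"
proof -
  have *: "((\<lambda>t. - f (- t)) has_real_derivative deriv f (- t)) (at t)" for t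
    using DERIV_minus[OF increasing_diffD(1)[OF assms, of "- t", unfolded DERIV_mirror]] by simp
  show "deriv (\<lambda>t. - f (- t)) t = deriv f (- t)" by (rule DERIV_imp_deriv[OF *])
  show "increasing_diff (\<lambda>t. - f (- t))"
    unfolding increasing_diff_def using * assms[THEN increasing_diffD(2)] by blast
qed

lemma distortion_le_reflect:
  assumes "increasing_diff f" "distortion_le (\<lambda>t. - f (- t)) (- z) S"
  shows "distortion_le f z S"
  unfolding distortion_le_def
proof (intro conjI allI impI)
  show "0 \<le> S" using assms(2) by (simp add: distortion_le_def)
  fix u assume u: "S * \<bar>u - z\<bar> \<le> 1"
  have e: "\<bar>- u - - z\<bar> = \<bar>u - z\<bar>" by simp
  then have "S * \<bar>- u - - z\<bar> \<le> 1" using u by metis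
  then have "\<bar>ln (deriv (\<lambda>t. - f (- t)) (- u)) - ln (deriv (\<lambda>t. - f (- t)) (- z))\<bar> \<le> S * \<bar>- u - - z\<bar>"
    using assms(2) unfolding distortion_le_def by blast
  then show "\<bar>ln (deriv f u) - ln (deriv f z)\<bar> \<le> S * \<bar>u - z\<bar>"
    unfolding e increasing_diff_reflect(2)[OF assms(1)] by simp
qed

lemma repelling_fixed_point_left:
  assumes f: "increasing_diff f" and q: "0 \<le> q"
    and lip: "\<And>s t. \<bar>ln (deriv f s) - ln (deriv f t)\<bar> \<le> q * \<bar>s - t\<bar>"
    and y: "f y = y" and \<epsilon>: "0 < \<epsilon>" and down: "\<And>t. y - \<epsilon> < t \<Longrightarrow> t < y \<Longrightarrow> f t < t"
  obtains C where "0 \<le> C" "\<And>M. \<exists>\<delta>>0. \<forall>z. y - \<delta> < z \<and> z < y \<longrightarrow>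
      (\<exists>n. distortion_le (f ^^ n) z (C * deriv (f ^^ n) z) \<and> M \<le> deriv (f ^^ n) z)"
proof -
  let ?g = "\<lambda>t. - f (- t)"
  have g: "increasing_diff ?g" by (rule increasing_diff_reflect[OF f])
  have pow: "?g ^^ n = (\<lambda>t. - (f ^^ n) (- t))" for n
    by (induction n) (auto simp: fun_eq_iff)
  have glip: "\<bar>ln (deriv ?g s) - ln (deriv ?g t)\<bar> \<le> q * \<bar>s - t\<bar>" for s t
    using lip[of "- s" "- t"] by (simp add: increasing_diff_reflect(2)[OF f] abs_minus_commute)
  have gy: "?g (- y) = - y" using y by simp
  have up: "t < ?g t" if "- y < t" "t < - y + \<epsilon>" for t
    using down[of "- t"] that by simp
  obtain C where C: "0 \<le> C" "\<And>M. \<exists>\<delta>>0. \<forall>z. - y < z \<and> z < - y + \<delta> \<longrightarrow>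
      (\<exists>n. distortion_le (?g ^^ n) z (C * deriv (?g ^^ n) z) \<and> M \<le> deriv (?g ^^ n) z)"
    using repelling_fixed_point[OF g q glip gy \<epsilon> up] by blast
  show ?thesis
  proof (rule that[OF C(1)])
    fix M
    obtain \<delta> where \<delta>: "\<delta> > 0" "\<And>z. - y < z \<Longrightarrow> z < - y + \<delta> \<Longrightarrow>
      \<exists>n. distortion_le (?g ^^ n) z (C * deriv (?g ^^ n) z) \<and> M \<le> deriv (?g ^^ n) z"
      using C(2)[of M] by blast
    show "\<exists>\<delta>>0. \<forall>z. y - \<delta> < z \<and> z < y \<longrightarrow>
      (\<exists>n. distortion_le (f ^^ n) z (C * deriv (f ^^ n) z) \<and> M \<le> deriv (f ^^ n) z)"
    proof (intro exI[of _ \<delta>] conjI allI impI \<delta>(1))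
      fix z assume "y - \<delta> < z \<and> z < y"
      then obtain n where n: "distortion_le (?g ^^ n) (- z) (C * deriv (?g ^^ n) (- z))"
          "M \<le> deriv (?g ^^ n) (- z)"
        using \<delta>(2)[of "- z"] by force
      note fn = increasing_diff_funpow[OF f, of n]
      have "deriv (?g ^^ n) (- z) = deriv (f ^^ n) z"
        unfolding pow increasing_diff_reflect(2)[OF fn] by simp
      with n have "distortion_le (f ^^ n) z (C * deriv (f ^^ n) z)" "M \<le> deriv (f ^^ n) z"
        using distortion_le_reflect[OF fn, of z] by (simp_all add: pow)
      then show "\<exists>n. distortion_le (f ^^ n) z (C * deriv (f ^^ n) z) \<and> M \<le> deriv (f ^^ n) z"
        by blast
    qed
  qed
qed

lemma no_fixed_point_sign:
  fixes f :: "real \<Rightarrow> real"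
  assumes cont: "continuous_on UNIV f" and nofix: "\<And>t. a < t \<Longrightarrow> t < b \<Longrightarrow> f t \<noteq> t"
  shows "(\<forall>t. a < t \<and> t < b \<longrightarrow> t < f t) \<or> (\<forall>t. a < t \<and> t < b \<longrightarrow> f t < t)"
proof (rule ccontr)
  assume "\<not> ?thesis"
  then obtain s t where s: "a < s" "s < b" "f s < s" and t: "a < t" "t < b" "t < f t"
    using nofix by (meson linorder_neqE)
  have conn: "connected ((\<lambda>t. f t - t) ` {a<..<b})"
    by (intro connected_continuous_image continuous_intros continuous_on_subset[OF cont]) auto
  have "0 \<in> (\<lambda>t. f t - t) ` {a<..<b}"
    by (rule connectedD_interval[OF conn, of "f s - s" "f t - t"]) (use s t in auto)
  then show False using nofix by auto
qed

lemma reduce_mod_period: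
  obtains k :: int where "0 \<le> t + 2 * pi * of_int k" "t + 2 * pi * of_int k < 2 * pi"
proof
  let ?k = "- \<lfloor>t / (2 * pi)\<rfloor>"
  show "0 \<le> t + 2 * pi * of_int ?k" "t + 2 * pi * of_int ?k < 2 * pi"
    using floor_divide_lower[of "2 * pi" t] floor_divide_upper[of "2 * pi" t]
    by (simp_all add: algebra_simps)
qed

section \<open>The lifted group acting on the line\<close>

locale line_action =
  fixes L :: "(real \<Rightarrow> real) set" and \<phi> :: "real \<Rightarrow> real"
  assumes comp: "F \<in> L \<Longrightarrow> H \<in> L \<Longrightarrow> F \<circ> H \<in> L"
    and inverse: "F \<in> L \<Longrightarrow> \<exists>H\<in>L. (\<forall>t. H (F t) = t) \<and> (\<forall>t. F (H t) = t)"
    and translation: "(\<lambda>t. t + 2 * pi * of_int k) \<in> L"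
    and diff: "F \<in> L \<Longrightarrow> increasing_diff F"
    and log_lipschitz: "F \<in> L \<Longrightarrow> \<exists>q\<ge>0. \<forall>s t. \<bar>ln (deriv F s) - ln (deriv F t)\<bar> \<le> q * \<bar>s - t\<bar>"
    and weight_cont: "continuous_on UNIV \<phi>"
    and weight_pos: "0 < \<phi> t"
    and weight_periodic: "\<phi> (t + 2 * pi * of_int k) = \<phi> t"
begin

text \<open>Here \<open>\<phi>\<close> stands for the density of the metric in the angle coordinate,
  so this is the metric derivative. The weights cancel along an orbit, which keeps the chain rule
  exact.\<close>

definition D :: "(real \<Rightarrow> real) \<Rightarrow> real \<Rightarrow> real" where
  "D F t = deriv F t * \<phi> (F t) / \<phi> t"

definition nonexp :: "real set" where
  "nonexp = {y. \<forall>F\<in>L. D F y \<le> 1}"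

definition expands :: "real \<Rightarrow> real \<Rightarrow> real \<Rightarrow> bool" where
  "expands C \<mu> z \<longleftrightarrow> (\<exists>H\<in>L. distortion_le H z (C * deriv H z) \<and> \<mu> \<le> D H z)"

lemma id_in: "id \<in> L"
  using translation[of 0] by (simp add: id_def)

lemma funpow_in: "F \<in> L \<Longrightarrow> F ^^ n \<in> L"
  by (induction n) (auto intro: comp id_in)

lemma deriv_pos: "F \<in> L \<Longrightarrow> 0 < deriv F t"
  using diff increasing_diffD(2) by blast

lemma D_pos: "F \<in> L \<Longrightarrow> 0 < D F t"
  by (simp add: D_def deriv_pos weight_pos)

lemma D_comp: "F \<in> L \<Longrightarrow> H \<in> L \<Longrightarrow> D (F \<circ> H) t = D F (H t) * D H t"
  using weight_pos[of "H t"] by (simp add: D_def increasing_diff_comp diff)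

text \<open>Continuity of \<open>deriv F\<close> comes from exponentiating its Lipschitz
  logarithm.\<close>

lemma D_continuous:
  assumes "F \<in> L" shows "continuous_on UNIV (D F)"
proof -
  obtain q where q: "0 \<le> q" "\<And>s t. \<bar>ln (deriv F s) - ln (deriv F t)\<bar> \<le> q * \<bar>s - t\<bar>"
    using log_lipschitz[OF assms] by blast
  then have "q-lipschitz_on UNIV (\<lambda>t. ln (deriv F t))"
    by (auto simp: lipschitz_on_def dist_real_def)
  then have "continuous_on UNIV (\<lambda>t. exp (ln (deriv F t)))"
    by (intro continuous_intros lipschitz_on_continuous_on)
  then have "continuous_on UNIV (deriv F)"
    using deriv_pos[OF assms] by simp
  moreover have "continuous_on UNIV (\<lambda>t. \<phi> (F t))"
    by (rule continuous_on_compose2[OF weight_cont increasing_diff_continuous[OF diff[OF assms]]]) simp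
  ultimately show ?thesis
    unfolding D_def[abs_def] using weight_cont weight_pos
    by (intro continuous_intros) (auto simp: less_imp_neq[symmetric])
qed

text \<open>Periodicity reduces \<open>\<phi>\<close> to a compact interval, so any two of its
  values have ratio at most \<open>R\<close>, whatever \<open>F\<close> is.\<close>

lemma D_deriv_comparable:
  obtains \<kappa> where "1 \<le> \<kappa>" "\<And>F t. F \<in> L \<Longrightarrow> D F t \<le> \<kappa> * deriv F t"
    "\<And>F t. F \<in> L \<Longrightarrow> deriv F t \<le> \<kappa> * D F t"
proof -
  have c: "continuous_on {0..2*pi} \<phi>" using weight_cont continuous_on_subset by blast
  have ne: "{0..2*pi} \<noteq> {}" by simp
  obtain s where s: "\<And>t. t \<in> {0..2*pi} \<Longrightarrow> \<phi> s \<le> \<phi> t"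
    using continuous_attains_inf[OF compact_Icc ne c] by blast
  obtain s' where s': "\<And>t. t \<in> {0..2*pi} \<Longrightarrow> \<phi> t \<le> \<phi> s'"
    using continuous_attains_sup[OF compact_Icc ne c] by blast
  have b: "\<phi> s \<le> \<phi> t \<and> \<phi> t \<le> \<phi> s'" for t
  proof -
    obtain k :: int where "0 \<le> t + 2 * pi * of_int k" "t + 2 * pi * of_int k < 2 * pi"
      by (rule reduce_mod_period)
    with s[of "t + 2 * pi * of_int k"] s'[of "t + 2 * pi * of_int k"] show ?thesis
      by (simp add: weight_periodic)
  qed
  define R where "R = \<phi> s' / \<phi> s"
  have r: "\<phi> t \<le> R * \<phi> u" for t u
  proof -
    have "\<phi> t * \<phi> s \<le> \<phi> s' * \<phi> u" using b[of t] b[of u] weight_pos by (intro mult_mono) (auto simp: less_imp_le)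
    then show ?thesis using weight_pos[of s] by (simp add: R_def field_simps)
  qed
  show ?thesis
  proof (rule that[of R])
    show "1 \<le> R" using b[of s] weight_pos[of s] by (simp add: R_def)
    fix F t assume F: "F \<in> L"
    have "deriv F t * \<phi> (F t) \<le> deriv F t * (R * \<phi> t)"
      using deriv_pos[OF F] r by (intro mult_left_mono) (auto simp: less_imp_le)
    then show "D F t \<le> R * deriv F t"
      unfolding D_def using weight_pos[of t] by (simp add: divide_le_eq mult_ac)
    have "deriv F t * \<phi> t \<le> deriv F t * (R * \<phi> (F t))"
      using deriv_pos[OF F] r by (intro mult_left_mono) (auto simp: less_imp_le)
    then show "deriv F t \<le> R * D F t"
      unfolding D_def using weight_pos[of t] by (simp add: pos_le_divide_eq mult_ac)
  qed
qed

lemma expands_mono: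
  assumes "expands C \<mu> z" "C \<le> C'" "\<mu>' \<le> \<mu>"
  shows "expands C' \<mu>' z"
proof -
  obtain H where H: "H \<in> L" "distortion_le H z (C * deriv H z)" "\<mu> \<le> D H z"
    using assms(1) unfolding expands_def by blast
  have "C * deriv H z \<le> C' * deriv H z"
    using assms(2) deriv_pos[OF H(1), of z] by simp
  from H(1) distortion_le_mono[OF H(2) this] H(3) assms(3) show ?thesis
    unfolding expands_def by (intro bexI[of _ H]) auto
qed

lemma not_nonexp_if_expands: "expands C \<mu> z \<Longrightarrow> 1 < \<mu> \<Longrightarrow> z \<notin> nonexp"
  unfolding expands_def nonexp_def by force

lemma expands_translate:
  assumes "expands C \<mu> (z + 2 * pi * of_int k)"
  shows "expands C \<mu> z"
proof -
  let ?T = "\<lambda>t::real. t + 2 * pi * of_int k"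
  have dT: "deriv ?T t = 1" for t by (rule DERIV_imp_deriv) (auto intro!: derivative_eq_intros)
  have T: "?T \<in> L" by (rule translation)
  obtain H where H: "H \<in> L" "distortion_le H (?T z) (C * deriv H (?T z))" "\<mu> \<le> D H (?T z)"
    using assms unfolding expands_def by blast
  have d: "deriv (H \<circ> ?T) t = deriv H (?T t)" for t
    using increasing_diff_comp(2)[OF diff[OF H(1)] diff[OF T]] dT by simp
  have "distortion_le (H \<circ> ?T) z (C * deriv H (?T z))"
    using H(2) unfolding distortion_le_def d
    by (metis add_diff_cancel_right)
  moreover have "D (H \<circ> ?T) z = D H (?T z)"
    unfolding D_def d using weight_periodic[of z k] by simp
  ultimately show ?thesis
    unfolding expands_def using H comp[OF H(1) T] d by (intro bexI[of _ "H \<circ> ?T"]) auto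
qed

lemma nonexp_translate: "z + 2 * pi * of_int k \<in> nonexp \<longleftrightarrow> z \<in> nonexp"
proof -
  have *: "z \<in> nonexp" if w: "z + 2 * pi * of_int k \<in> nonexp" for z k
  proof (rule ccontr)
    assume "z \<notin> nonexp"
    then obtain F where F: "F \<in> L" "1 < D F z" unfolding nonexp_def by force
    let ?T = "\<lambda>t::real. t + 2 * pi * of_int (- k)" and ?w = "z + 2 * pi * of_int k"
    have dT: "deriv ?T t = 1" for t by (rule DERIV_imp_deriv) (auto intro!: derivative_eq_intros)
    have "D ?T ?w = 1" unfolding D_def dT weight_periodic using weight_pos[of z] by simp
    then have "D (F \<circ> ?T) ?w = D F z"
      unfolding D_comp[OF F(1) translation] by simp
    with F(2) have "\<not> D (F \<circ> ?T) ?w \<le> 1" by simp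
    with comp[OF F(1) translation] w show False unfolding nonexp_def by blast
  qed
  from *[of z k] *[of "z + 2 * pi * of_int k" "- k"] show ?thesis by auto
qed

text \<open>A single \<open>F\<close> with \<open>1 < D F y\<close> works near \<open>y\<close> by
  continuity. Its distortion bound is a constant \<open>q\<close>, but \<open>D F z\<close> above 1
  keeps \<open>deriv F z\<close> above \<open>1 / \<kappa>\<close>, so \<open>q\<close> can be
  rewritten as a multiple of \<open>deriv F z\<close>.\<close>

lemma bounded_expansion_near_expandable:
  assumes "y \<notin> nonexp"
  shows "\<exists>C \<mu> \<delta>. 1 < \<mu> \<and> 0 < \<delta> \<and> (\<forall>z. \<bar>z - y\<bar> < \<delta> \<longrightarrow> expands C \<mu> z)"
proof -
  obtain F where F: "F \<in> L" "1 < D F y" using assms unfolding nonexp_def by force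
  obtain q where q: "0 \<le> q" "\<And>s t. \<bar>ln (deriv F s) - ln (deriv F t)\<bar> \<le> q * \<bar>s - t\<bar>"
    using log_lipschitz[OF F(1)] by blast
  obtain \<kappa> where \<kappa>: "1 \<le> \<kappa>" "\<And>F t. F \<in> L \<Longrightarrow> D F t \<le> \<kappa> * deriv F t"
    using D_deriv_comparable by metis
  define \<mu> where "\<mu> = (1 + D F y) / 2"
  have \<mu>: "1 < \<mu>" "\<mu> < D F y" using F(2) by (auto simp: \<mu>_def)
  have "isCont (D F) y" using D_continuous[OF F(1)] by (simp add: continuous_on_eq_continuous_at)
  from order_tendstoD(1)[OF this[unfolded isCont_def] \<mu>(2)]
  obtain \<delta> where \<delta>: "\<delta> > 0" "\<And>z. z \<noteq> y \<Longrightarrow> \<bar>z - y\<bar> < \<delta> \<Longrightarrow> \<mu> < D F z"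
    unfolding eventually_at dist_real_def by blast
  show ?thesis
  proof (intro exI conjI allI impI)
    show "1 < \<mu>" "0 < \<delta>" by fact+
    fix z assume "\<bar>z - y\<bar> < \<delta>"
    with \<delta>(2)[of z] \<mu> have z: "\<mu> \<le> D F z" by (cases "z = y") auto
    with \<kappa>(2)[OF F(1), of z] \<mu>(1) have "1 \<le> \<kappa> * deriv F z" by linarith
    with q(1) have "q * 1 \<le> q * (\<kappa> * deriv F z)" by (rule mult_left_mono[rotated])
    then have "distortion_le F z ((q * \<kappa>) * deriv F z)"
      using distortion_le_mono[OF distortion_le_lipschitz[OF q]] by (simp add: mult_ac)
    with F(1) z show "expands (q * \<kappa>) \<mu> z" unfolding expands_def by blast
  qed
qed

text \<open>Without fixed points in the interval, \<open>F\<close> moves all its points in one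
  direction; if that is towards \<open>y\<close>, the inverse moves them away.\<close>

lemma repelling_right:
  assumes "F \<in> L" "F y = y" "\<And>t. y < t \<Longrightarrow> t < y + \<epsilon> \<Longrightarrow> F t \<noteq> t"
  shows "\<exists>f\<in>L. f y = y \<and> (\<forall>t. y < t \<and> t < y + \<epsilon> \<longrightarrow> t < f t)"
  using no_fixed_point_sign[OF increasing_diff_continuous[OF diff[OF assms(1)]] assms(3)]
proof
  assume down: "\<forall>t. y < t \<and> t < y + \<epsilon> \<longrightarrow> F t < t"
  obtain H where H: "H \<in> L" "\<And>t. H (F t) = t" using inverse[OF assms(1)] by blast
  have "strict_mono H" using H(1) diff increasing_diff_strict_mono by blast
  then have "t < H t" if "y < t \<and> t < y + \<epsilon>" for t
    using down that H(2) by (metis strict_mono_less)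
  moreover have "H y = y" using H(2)[of y] assms(2) by simp
  ultimately show ?thesis using H(1) by blast
qed (use assms(1,2) in \<open>auto intro!: bexI[of _ F]\<close>)

lemma repelling_left:
  assumes "F \<in> L" "F y = y" "\<And>t. y - \<epsilon> < t \<Longrightarrow> t < y \<Longrightarrow> F t \<noteq> t"
  shows "\<exists>f\<in>L. f y = y \<and> (\<forall>t. y - \<epsilon> < t \<and> t < y \<longrightarrow> f t < t)"
  using no_fixed_point_sign[OF increasing_diff_continuous[OF diff[OF assms(1)]] assms(3)]
proof
  assume up: "\<forall>t. y - \<epsilon> < t \<and> t < y \<longrightarrow> t < F t"
  obtain H where H: "H \<in> L" "\<And>t. H (F t) = t" using inverse[OF assms(1)] by blast
  have "strict_mono H" using H(1) diff increasing_diff_strict_mono by blast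
  then have "H t < t" if "y - \<epsilon> < t \<and> t < y" for t
    using up that H(2) by (metis strict_mono_less)
  moreover have "H y = y" using H(2)[of y] assms(2) by simp
  ultimately show ?thesis using H(1) by blast
qed (use assms(1,2) in \<open>auto intro!: bexI[of _ F]\<close>)

text \<open>The two sides use unrelated maps, and the larger constant serves both. Together with
  \<open>not_nonexp_if_expands\<close> this isolates \<open>y\<close> among the non-expandable
  points.\<close>

lemma bounded_expansion_near_isolated_fixed_point:
  assumes "0 < \<epsilon>"
    and F: "F \<in> L" "F y = y" "\<And>t. y < t \<Longrightarrow> t < y + \<epsilon> \<Longrightarrow> F t \<noteq> t"
    and H: "H \<in> L" "H y = y" "\<And>t. y - \<epsilon> < t \<Longrightarrow> t < y \<Longrightarrow> H t \<noteq> t"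
  obtains C \<delta> where "0 < \<delta>" "\<And>z. \<bar>z - y\<bar> < \<delta> \<Longrightarrow> z \<noteq> y \<Longrightarrow> expands C 2 z"
proof -
  obtain \<kappa> where \<kappa>: "1 \<le> \<kappa>" "\<And>F t. F \<in> L \<Longrightarrow> deriv F t \<le> \<kappa> * D F t"
    using D_deriv_comparable by metis
  \<comment> \<open>Asking for \<open>2 * \<kappa>\<close> from the plain derivative leaves the
    factor 2 for \<open>D\<close>.\<close>
  have ex: "expands C 2 z"
    if fL: "f \<in> L" and fn: "\<exists>n. distortion_le (f ^^ n) z (C * deriv (f ^^ n) z) \<and> 2 * \<kappa> \<le> deriv (f ^^ n) z"
    for f C z
  proof -
    obtain n where n: "distortion_le (f ^^ n) z (C * deriv (f ^^ n) z)" "2 * \<kappa> \<le> deriv (f ^^ n) z"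
      using fn by blast
    have "\<kappa> * 2 \<le> \<kappa> * D (f ^^ n) z"
      using \<kappa>(2)[OF funpow_in[OF fL], of n z] n(2) by linarith
    then have "2 \<le> D (f ^^ n) z" using \<kappa>(1) by simp
    with n(1) funpow_in[OF fL] show ?thesis unfolding expands_def by blast
  qed
  obtain f where f: "f \<in> L" "f y = y" "\<And>t. y < t \<Longrightarrow> t < y + \<epsilon> \<Longrightarrow> t < f t"
    using repelling_right[OF F] by blast
  obtain q where q: "0 \<le> q" "\<And>s t. \<bar>ln (deriv f s) - ln (deriv f t)\<bar> \<le> q * \<bar>s - t\<bar>"
    using log_lipschitz[OF f(1)] by blast
  obtain C \<delta> where C: "0 < \<delta>" "\<And>z. y < z \<Longrightarrow> z < y + \<delta> \<Longrightarrow> expands C 2 z"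
    using repelling_fixed_point[OF diff[OF f(1)] q f(2) assms(1) f(3)] ex[OF f(1)] by metis
  obtain g where g: "g \<in> L" "g y = y" "\<And>t. y - \<epsilon> < t \<Longrightarrow> t < y \<Longrightarrow> g t < t"
    using repelling_left[OF H] by blast
  obtain q' where q': "0 \<le> q'" "\<And>s t. \<bar>ln (deriv g s) - ln (deriv g t)\<bar> \<le> q' * \<bar>s - t\<bar>"
    using log_lipschitz[OF g(1)] by blast
  obtain C' \<delta>' where C': "0 < \<delta>'" "\<And>z. y - \<delta>' < z \<Longrightarrow> z < y \<Longrightarrow> expands C' 2 z"
    using repelling_fixed_point_left[OF diff[OF g(1)] q' g(2) assms(1) g(3)] ex[OF g(1)] by metis
  show ?thesis
  proof (rule that[of "min \<delta> \<delta>'" "max C C'"])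
    fix z assume z: "\<bar>z - y\<bar> < min \<delta> \<delta>'" "z \<noteq> y"
    show "expands (max C C') 2 z"
    proof (cases "y < z")
      case True
      then show ?thesis using C(2)[of z] z expands_mono by fastforce
    next
      case False
      then show ?thesis using C'(2)[of z] z expands_mono by fastforce
    qed
  qed (use C C' in simp)
qed

end

section \<open>Uniform constants by compactness\<close>

locale star_line_action = line_action +
  assumes star: "y \<in> nonexp \<Longrightarrow> \<exists>F\<in>L. \<exists>H\<in>L. \<exists>\<epsilon>>0. F y = y \<and> H y = y \<and>
      (\<forall>t. y < t \<and> t < y + \<epsilon> \<longrightarrow> F t \<noteq> t) \<and> (\<forall>t. y - \<epsilon> < t \<and> t < y \<longrightarrow> H t \<noteq> t)"
begin

text \<open>A single integer parameter controls both the distortion and the expansion, so that a finite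
  subcover yields uniform constants by taking one maximum.\<close>

lemma expands_locally:
  "\<exists>n. \<exists>\<delta>>0. \<forall>z. \<bar>z - y\<bar> < \<delta> \<longrightarrow> z \<noteq> y \<or> y \<notin> nonexp \<longrightarrow> expands (real n) (1 + 1 / (real n + 1)) z"
proof -
  obtain C \<mu> \<delta> where *: "1 < \<mu>" "0 < \<delta>"
    "\<And>z. \<bar>z - y\<bar> < \<delta> \<Longrightarrow> z \<noteq> y \<or> y \<notin> nonexp \<Longrightarrow> expands C \<mu> z"
  proof (cases "y \<in> nonexp")
    case True
    then obtain F H \<epsilon> where e: "\<epsilon> > 0" and FH: "F \<in> L" "F y = y" "H \<in> L" "H y = y" and nofix:
      "\<And>t. y < t \<Longrightarrow> t < y + \<epsilon> \<Longrightarrow> F t \<noteq> t" "\<And>t. y - \<epsilon> < t \<Longrightarrow> t < y \<Longrightarrow> H t \<noteq> t"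
      using star by meson
    obtain C \<delta> where d: "0 < \<delta>" "\<And>z. \<bar>z - y\<bar> < \<delta> \<Longrightarrow> z \<noteq> y \<Longrightarrow> expands C 2 z"
      using bounded_expansion_near_isolated_fixed_point[OF e FH(1,2) nofix(1) FH(3,4) nofix(2)] by blast
    show ?thesis
      by (rule that[where \<mu> = 2 and \<delta> = \<delta> and C = C]) (use True d in simp_all)
  next
    case False
    obtain C \<mu> \<delta> where "1 < \<mu>" "0 < \<delta>" "\<And>z. \<bar>z - y\<bar> < \<delta> \<Longrightarrow> expands C \<mu> z"
      using bounded_expansion_near_expandable[OF False] by blast
    then show ?thesis by (rule that)
  qed
  \<comment> \<open>The requirements are \<open>C \<le> n\<close> and
    \<open>1 / (n + 1) \<le> \<mu> - 1\<close>; the shift by 1 keeps the factor above 1 even for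
    \<open>n = 0\<close>.\<close>
  obtain n :: nat where n: "max C (1 / (\<mu> - 1)) \<le> real n" using real_arch_simple by blast
  then have "1 / (\<mu> - 1) \<le> real n + 1" by simp
  then have "1 \<le> (real n + 1) * (\<mu> - 1)" using *(1) by (simp add: divide_le_eq)
  then have "1 / (real n + 1) \<le> \<mu> - 1" by (simp add: divide_le_eq mult.commute)
  then have "1 + 1 / (real n + 1) \<le> \<mu>" by simp
  moreover have "C \<le> real n" using n by simp
  ultimately show ?thesis
    using *(2,3) by (intro exI[of _ n] exI[of _ \<delta>]) (blast intro: expands_mono)
qed

text \<open>One finite subcover gives both claims. In the ball about a centre every other point
  expands, so a non-expandable point must be a centre. A point outside \<open>nonexp\<close> never
  coincides with a non-expandable centre, so the local statement applies to it, and the largest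
  parameter serves all balls.\<close>

lemma
  shows finite_nonexp: "finite (nonexp \<inter> {0..2 * pi})"
    and uniform_expansion: "\<exists>n. \<forall>z. z \<notin> nonexp \<longrightarrow> expands (real n) (1 + 1 / (real n + 1)) z"
proof -
  obtain N \<delta> where \<delta>: "\<And>y. 0 < \<delta> y" and
    N: "\<And>y z. \<bar>z - y\<bar> < \<delta> y \<Longrightarrow> z \<noteq> y \<or> y \<notin> nonexp \<Longrightarrow> expands (real (N y)) (1 + 1 / (real (N y) + 1)) z"
    using expands_locally by metis
  have "{0..2 * pi} \<subseteq> (\<Union>y\<in>{0..2 * pi}. ball y (\<delta> y))" using \<delta> by force
  then obtain Y where Y: "finite Y" "{0..2 * pi} \<subseteq> (\<Union>y\<in>Y. ball y (\<delta> y))"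
    by (rule compactE_image[OF compact_Icc _, rotated]) auto
  have cover: "\<exists>y\<in>Y. \<bar>z - y\<bar> < \<delta> y" if "0 \<le> z" "z \<le> 2 * pi" for z
    using Y(2) that by (force simp: dist_real_def abs_minus_commute)
  have "nonexp \<inter> {0..2 * pi} \<subseteq> Y"
  proof
    fix z assume z: "z \<in> nonexp \<inter> {0..2 * pi}"
    then obtain y where y: "y \<in> Y" "\<bar>z - y\<bar> < \<delta> y" using cover by auto
    have "z = y"
      using N[OF y(2)] z not_nonexp_if_expands[of "real (N y)" "1 + 1 / (real (N y) + 1)" z] by auto
    with y show "z \<in> Y" by simp
  qed
  with Y(1) show "finite (nonexp \<inter> {0..2 * pi})" using finite_subset by blast
  define n where "n = Max (N ` Y)"
  have "expands (real n) (1 + 1 / (real n + 1)) z" if z: "z \<notin> nonexp" for z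
  proof -
    obtain k :: int where k: "0 \<le> z + 2 * pi * of_int k" "z + 2 * pi * of_int k < 2 * pi"
      by (rule reduce_mod_period)
    define w where "w = z + 2 * pi * of_int k"
    have w: "w \<notin> nonexp" using z by (simp add: w_def nonexp_translate)
    obtain y where y: "y \<in> Y" "\<bar>w - y\<bar> < \<delta> y" using cover[of w] k by (auto simp: w_def)
    have "N y \<le> n" using y(1) Y(1) by (simp add: n_def)
    then have "1 / (real n + 1) \<le> 1 / (real (N y) + 1)" by (intro divide_left_mono) auto
    moreover have "w \<noteq> y \<or> y \<notin> nonexp" using w by auto
    ultimately have "expands (real n) (1 + 1 / (real n + 1)) w"
      using \<open>N y \<le> n\<close> by (intro expands_mono[OF N[OF y(2)]]) auto
    then show ?thesis unfolding w_def by (rule expands_translate)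
  qed
  then show "\<exists>n. \<forall>z. z \<notin> nonexp \<longrightarrow> expands (real n) (1 + 1 / (real n + 1)) z" by blast
qed

text \<open>The induction appends at \<open>F x\<close> an expanding map \<open>H\<close>. The new
  distortion is at most \<open>C * D F x + A * D (H \<circ> F) x\<close>, and \<open>D F x\<close>
  is at most a \<open>1 / \<mu>\<close> share of \<open>D (H \<circ> F) x\<close>; so the bound
  reproduces itself once \<open>C / \<mu> + A \<le> C\<close>.\<close>

lemma unbounded_expansion:
  obtains C where "0 < C"
    "\<And>x M. (\<And>F. F \<in> L \<Longrightarrow> F x \<notin> nonexp) \<Longrightarrow> \<exists>F\<in>L. distortion_le F x (C * D F x) \<and> M \<le> D F x"
proof -
  obtain N where N: "\<And>z. z \<notin> nonexp \<Longrightarrow> expands (real N) (1 + 1 / (real N + 1)) z"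
    using uniform_expansion by blast
  obtain \<kappa> where \<kappa>: "1 \<le> \<kappa>" "\<And>F t. F \<in> L \<Longrightarrow> deriv F t \<le> \<kappa> * D F t"
    using D_deriv_comparable by metis
  define \<mu> where "\<mu> = 1 + 1 / (real N + 1)"
  have \<mu>: "1 < \<mu>" by (simp add: \<mu>_def)
  \<comment> \<open>\<open>exp 1\<close> is the loss in \<open>distortion_le_comp\<close>,
    \<open>real N\<close> the constant of \<open>H\<close>, and \<open>\<kappa>\<close> turns
    \<open>deriv\<close> into \<open>D\<close>.\<close>
  define A where "A = exp 1 * real N * \<kappa>"
  have A: "0 \<le> A" using \<kappa>(1) by (simp add: A_def)
  \<comment> \<open>The quotient is the sum of the geometric series with first term \<open>A\<close>
    and ratio \<open>1 / \<mu>\<close>; adding 1 keeps \<open>C\<close> positive when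
    \<open>N = 0\<close>.\<close>
  define C where "C = A * \<mu> / (\<mu> - 1) + 1"
  have C: "0 < C" using A \<mu> by (simp add: C_def add_nonneg_pos)
  have C\<mu>: "C + A * \<mu> \<le> C * \<mu>"
  proof -
    have "C * (\<mu> - 1) = A * \<mu> + (\<mu> - 1)" using \<mu> by (simp add: C_def distrib_right)
    then show ?thesis using \<mu> by (simp add: algebra_simps)
  qed
  have step: "\<exists>F\<in>L. distortion_le F x (C * D F x) \<and> \<mu> ^ n \<le> D F x"
    if x: "\<And>F. F \<in> L \<Longrightarrow> F x \<notin> nonexp" for x n
  proof (induction n)
    case 0
    have "deriv id t = (1::real)" for t :: real
      by (rule DERIV_imp_deriv) (simp add: id_def)
    then have "distortion_le id x (C * D id x)" "D id x = 1"
      using C weight_pos[of x] by (auto simp: distortion_le_def D_def)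
    then show ?case by (intro bexI[OF _ id_in]) (simp only: power_0 order_refl simp_thms)
  next
    case (Suc n)
    then obtain F where F: "F \<in> L" "distortion_le F x (C * D F x)" "\<mu> ^ n \<le> D F x" by blast
    obtain H where H: "H \<in> L" "distortion_le H (F x) (real N * deriv H (F x))" "\<mu> \<le> D H (F x)"
      using N[OF x[OF F(1)]] unfolding expands_def \<mu>_def[symmetric] by blast
    have HF: "H \<circ> F \<in> L" by (rule comp[OF H(1) F(1)])
    have DHF: "D (H \<circ> F) x = D H (F x) * D F x" by (rule D_comp[OF H(1) F(1)])
    note pos = D_pos[OF F(1), of x] D_pos[OF H(1), of "F x"]
    have ge: "\<mu> * D F x \<le> D (H \<circ> F) x"
      unfolding DHF using H(3) pos by simp
    have "exp 1 * (real N * deriv H (F x)) * deriv F x = exp 1 * real N * deriv (H \<circ> F) x"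
      by (simp add: increasing_diff_comp diff F H)
    also have "\<dots> \<le> exp 1 * real N * (\<kappa> * D (H \<circ> F) x)"
      using \<kappa>(2)[OF HF] by (intro mult_left_mono) auto
    also have "\<dots> = A * D (H \<circ> F) x" by (simp add: A_def)
    finally have 1: "exp 1 * (real N * deriv H (F x)) * deriv F x \<le> A * D (H \<circ> F) x" .
    have "\<mu> * (C * D F x + A * D (H \<circ> F) x) \<le> C * D (H \<circ> F) x + A * \<mu> * D (H \<circ> F) x"
      using mult_left_mono[OF ge, of C] C by (simp add: algebra_simps)
    also have "\<dots> \<le> \<mu> * (C * D (H \<circ> F) x)"
      using mult_right_mono[OF C\<mu>, of "D (H \<circ> F) x"] D_pos[OF HF, of x] by (simp add: algebra_simps)
    finally have "C * D F x + A * D (H \<circ> F) x \<le> C * D (H \<circ> F) x" using \<mu> by simp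
    with 1 have "C * D F x + exp 1 * (real N * deriv H (F x)) * deriv F x \<le> C * D (H \<circ> F) x" by linarith
    then have "distortion_le (H \<circ> F) x (C * D (H \<circ> F) x)"
      by (rule distortion_le_mono[OF distortion_le_comp[OF diff[OF F(1)] F(2) diff[OF H(1)] H(2)]])
    moreover have "\<mu> ^ Suc n \<le> D (H \<circ> F) x"
      using ge F(3) \<mu> by (auto intro: order_trans[OF mult_left_mono])
    ultimately show ?case using HF by blast
  qed
  show ?thesis
  proof (rule that[OF C])
    fix x M assume x: "\<And>F. F \<in> L \<Longrightarrow> F x \<notin> nonexp"
    obtain n where "M < \<mu> ^ n" using real_arch_pow[OF \<mu>] by blast
    with step[where n = n, OF x] show "\<exists>F\<in>L. distortion_le F x (C * D F x) \<and> M \<le> D F x" by force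
  qed
qed

end

section \<open>Ergodicity on the line\<close>

lemma lmeasurable_Int_ball:
  fixes A :: "real set"
  assumes "A \<in> sets lebesgue" shows "A \<inter> ball x r \<in> lmeasurable"
  using assms by (intro bounded_set_imp_lmeasurable) auto

text \<open>This replaces the Lebesgue density theorem.\<close>

lemma negligible_if_thin_lmeasurable:
  fixes A :: "real set"
  assumes A: "A \<in> lmeasurable" and c: "0 < c" "c \<le> 1" and N: "negligible N"
    and thin: "\<And>x d. x \<in> A - N \<Longrightarrow> 0 < d \<Longrightarrow> \<exists>r. 0 < r \<and> r < d \<and>
      measure lebesgue (A \<inter> ball x r) \<le> (1 - c) * measure lebesgue (ball x r)"
  shows "negligible A"
proof (rule ccontr)
  let ?m = "measure lebesgue" and ?e = "emeasure lebesgue"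
  let ?B = "\<lambda>i. ball (fst i) (snd i) :: real set"
  assume "\<not> negligible A"
  then have pos: "0 < ?m A" using A negligible_iff_measure0 zero_less_measure_iff by force
  have As: "A \<in> sets lebesgue" using A by blast
  \<comment> \<open>The excess of \<open>T\<close> over \<open>A\<close> stays below
    \<open>c * ?m A\<close>, so that the final factor \<open>(1 - c) * (1 + c)\<close> is less than
    1.\<close>
  obtain T where T: "open T" "A \<subseteq> T" "T - A \<in> lmeasurable" "?e (T - A) < ennreal (c * ?m A)"
    using sets_lebesgue_outer_open[OF As, of "c * ?m A"] c(1) pos by auto
  have TA: "T = A \<union> (T - A)" using T(2) by auto
  have eT: "?e T \<le> ennreal (?m A + c * ?m A)"
  proof -
    have "?e T = ?e A + ?e (T - A)"
      using T As by (subst TA, subst plus_emeasure[symmetric]) auto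
    also have "\<dots> \<le> ennreal (?m A) + ennreal (c * ?m A)"
      using T(4) A by (intro add_mono) (auto simp: emeasure_eq_measure2)
    finally show ?thesis using pos c by (simp add: ennreal_plus)
  qed
  define K where "K = {(x, r). x \<in> A - N \<and> 0 < r \<and> ball x r \<subseteq> T \<and>
      ?m (A \<inter> ball x r) \<le> (1 - c) * ?m (ball x r)}"
  have cover: "\<exists>i. i \<in> K \<and> x \<in> ?B i \<and> snd i < d" if x: "x \<in> A - N" and d: "0 < d" for x d
  proof -
    obtain e where e: "e > 0" "ball x e \<subseteq> T" using T(1,2) x open_contains_ball by blast
    obtain r where r: "0 < r" "r < min d e" "?m (A \<inter> ball x r) \<le> (1 - c) * ?m (ball x r)"
      using thin[OF x, of "min d e"] d e by auto
    then have "(x, r) \<in> K" using x e by (auto simp: K_def)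
    then show ?thesis using r by (intro exI[of _ "(x, r)"]) auto
  qed
  \<comment> \<open>Disjoint thin balls inside \<open>T\<close> exhaust \<open>A\<close> up to a
    null set, so the measure of \<open>A\<close> is at most \<open>1 - c\<close> times that of
    \<open>T\<close>.\<close>
  obtain C where C: "countable C" "C \<subseteq> K" "pairwise (\<lambda>i j. disjnt (?B i) (?B j)) C"
      "negligible ((A - N) - (\<Union>i\<in>C. ?B i))"
    by (rule Vitali_covering_theorem_balls[of "A - N" K fst snd]) (use cover in auto)
  have disj: "disjoint_family_on ?B C" "disjoint_family_on (\<lambda>i. A \<inter> ?B i) C"
    using C(3) unfolding disjoint_family_on_def pairwise_def disjnt_def by blast+
  have "?e A \<le> ?e ((\<Union>i\<in>C. A \<inter> ?B i) \<union> (((A - N) - (\<Union>i\<in>C. ?B i)) \<union> N))"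
    using As C(1) N C(4)
    by (intro emeasure_mono sets.Un sets.countable_UN') (auto simp: negligible_imp_sets)
  also have "\<dots> = ?e (\<Union>i\<in>C. A \<inter> ?B i)"
    using As C(1) N C(4)
    by (intro emeasure_Un_null_set sets.countable_UN') (auto simp: negligible_iff_null_sets)
  also have "\<dots> = (\<integral>\<^sup>+i. ?e (A \<inter> ?B i) \<partial>count_space C)"
    using As C(1) disj by (intro emeasure_UN_countable) auto
  also have "\<dots> \<le> (\<integral>\<^sup>+i. ennreal (1 - c) * ?e (?B i) \<partial>count_space C)"
  proof (rule nn_integral_mono)
    fix i assume "i \<in> space (count_space C)"
    then have "?m (A \<inter> ?B i) \<le> (1 - c) * ?m (?B i)" using C(2) by (auto simp: K_def)
    then have "ennreal (?m (A \<inter> ?B i)) \<le> ennreal (1 - c) * ennreal (?m (?B i))"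
      using c by (simp add: ennreal_mult[symmetric] ennreal_leI)
    moreover have "A \<inter> ?B i \<in> lmeasurable" "?B i \<in> lmeasurable"
      using lmeasurable_Int_ball[OF As] by auto
    ultimately show "?e (A \<inter> ?B i) \<le> ennreal (1 - c) * ?e (?B i)"
      by (simp add: emeasure_eq_measure2)
  qed
  also have "\<dots> = ennreal (1 - c) * ?e (\<Union>i\<in>C. ?B i)"
    using C(1) disj by (subst emeasure_UN_countable) (auto simp: nn_integral_cmult)
  also have "\<dots> \<le> ennreal (1 - c) * ?e T"
  proof (intro mult_left_mono emeasure_mono UN_least)
    show "?B i \<subseteq> T" if "i \<in> C" for i
      using that C(2) by (cases i) (auto simp: K_def)
  qed (use T(1) in auto)
  also have "\<dots> \<le> ennreal (1 - c) * ennreal (?m A + c * ?m A)"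
    using eT by (intro mult_left_mono) auto
  also have "\<dots> = ennreal ((1 - c) * (?m A + c * ?m A))"
    using c pos by (simp add: ennreal_mult)
  finally have "?m A \<le> (1 - c) * (?m A + c * ?m A)"
    using A c pos by (simp add: emeasure_eq_measure2)
  also have "\<dots> = ?m A - c * c * ?m A" by (simp add: algebra_simps)
  finally have "c * c * ?m A \<le> 0" by simp
  moreover have "0 < c * c * ?m A" using c pos by simp
  ultimately show False by linarith
qed

text \<open>Thinness passes to subsets, so \<open>A\<close> may be cut by balls about 0 into pieces
  of finite measure.\<close>

lemma negligible_if_thin:
  fixes A :: "real set"
  assumes A: "A \<in> sets lebesgue" and c: "0 < c" "c \<le> 1" and N: "negligible N"
    and thin: "\<And>x d. x \<in> A - N \<Longrightarrow> 0 < d \<Longrightarrow> \<exists>r. 0 < r \<and> r < d \<and>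
      measure lebesgue (A \<inter> ball x r) \<le> (1 - c) * measure lebesgue (ball x r)"
  shows "negligible A"
proof -
  have "negligible (A \<inter> ball 0 (real n))" for n
  proof (rule negligible_if_thin_lmeasurable[OF _ c N])
    have [simp]: "A \<inter> ball x r \<in> lmeasurable" for x r
      using A by (rule lmeasurable_Int_ball)
    show "A \<inter> ball 0 (real n) \<in> lmeasurable" by simp
    fix x d :: real assume "x \<in> A \<inter> ball 0 (real n) - N" "0 < d"
    then obtain r where r: "0 < r" "r < d"
      "measure lebesgue (A \<inter> ball x r) \<le> (1 - c) * measure lebesgue (ball x r)"
      using thin[of x d] by auto
    have "measure lebesgue (A \<inter> ball 0 (real n) \<inter> ball x r) \<le> measure lebesgue (A \<inter> ball x r)"
      using fmeasurableD[OF lmeasurable_Int_ball[OF fmeasurableD[OF lmeasurable_Int_ball[OF A]]]]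
      by (intro measure_mono_fmeasurable) auto
    with r show "\<exists>r. 0 < r \<and> r < d \<and> measure lebesgue (A \<inter> ball 0 (real n) \<inter> ball x r)
        \<le> (1 - c) * measure lebesgue (ball x r)"
      by (intro exI[of _ r]) auto
  qed
  then have "negligible (\<Union>n. A \<inter> ball 0 (real n))"
    by (intro negligible_countable_Union) auto
  moreover have "A = (\<Union>n. A \<inter> ball 0 (real n))"
    by (auto simp: reals_Archimedean2)
  ultimately show ?thesis by simp
qed

text \<open>Used to bound the measure of \<open>B\<close> from below by that of its image, for which
  an upper bound on the derivative suffices.\<close>

lemma measure_increasing_image_le:
  assumes F: "increasing_diff F" and B: "B \<in> sets lebesgue" "bounded B"
    and M: "\<And>t. t \<in> B \<Longrightarrow> deriv F t \<le> M"
  shows "F ` B \<in> lmeasurable" "measure lebesgue (F ` B) \<le> M * measure lebesgue B"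
proof -
  have Bm: "B \<in> lmeasurable" using B bounded_set_imp_lmeasurable by blast
  have der: "(F has_field_derivative deriv F t) (at t within S)" for t S
    using increasing_diffD(1)[OF F] has_field_derivative_at_within by blast
  have inj: "inj_on F B"
    using strict_mono_imp_inj_on[OF increasing_diff_strict_mono[OF F]] inj_on_subset by blast
  have "F differentiable_on B"
    using der unfolding differentiable_on_def real_differentiable_def by blast
  then have "F ` B \<in> sets lebesgue"
    using B(1) by (intro differentiable_image_in_sets_lebesgue) auto
  moreover have "bounded (F ` B)"
  proof -
    have "compact (F ` closure B)"
      using B(2) increasing_diff_continuous[OF F] by (intro compact_continuous_image) auto
    then show ?thesis
      using bounded_subset[OF compact_imp_bounded, of "F ` closure B" "F ` B"] closure_subset by blast
  qed
  ultimately show FB: "F ` B \<in> lmeasurable" using bounded_set_imp_lmeasurable by blast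
  then have "(\<lambda>x. 1::real) absolutely_integrable_on F ` B \<and>
      integral (F ` B) (\<lambda>x. 1) = measure lebesgue (F ` B)"
    by (simp add: lmeasure_integral absolutely_integrable_on_iff_nonneg lmeasurable_iff_integrable_on)
  then have *: "(\<lambda>x. \<bar>deriv F x\<bar> * 1) absolutely_integrable_on B \<and>
      integral B (\<lambda>x. \<bar>deriv F x\<bar> * 1) = measure lebesgue (F ` B)"
    using has_absolute_integral_change_of_variables_1'[OF B(1) der inj, of "\<lambda>x. 1"] by simp
  have "measure lebesgue (F ` B) = integral B (\<lambda>x. \<bar>deriv F x\<bar>)" using * by simp
  also have "\<dots> \<le> integral B (\<lambda>x. M)"
  proof (rule integral_le)
    show "(\<lambda>x. \<bar>deriv F x\<bar>) integrable_on B"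
      using * set_lebesgue_integral_eq_integral(1) by fastforce
    show "(\<lambda>x. M) integrable_on B" using Bm integrable_on_const by blast
    show "\<bar>deriv F x\<bar> \<le> M" if "x \<in> B" for x
      using M[OF that] increasing_diffD(2)[OF F, of x] by simp
  qed
  also have "\<dots> = M * measure lebesgue B"
    using lmeasure_integral[OF Bm] integral_mult_right[of B M "\<lambda>x. 1"] by simp
  finally show "measure lebesgue (F ` B) \<le> M * measure lebesgue B" .
qed

section \<open>Uniform mass of an invariant set in intervals of fixed length\<close>

lemma (in line_action) negligible_image:
  assumes "F \<in> L" "negligible B" shows "negligible (F ` B)"
proof (rule negligible_differentiable_image_negligible[OF _ assms(2)])
  show "F differentiable_on B"
    unfolding differentiable_on_def real_differentiable_def
    using increasing_diffD(1)[OF diff[OF assms(1)]] has_field_derivative_at_within by blast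
qed simp

context line_action
begin

context
  fixes B :: "real set"
  assumes dense: "\<forall>x a b. a < b \<longrightarrow> (\<exists>F\<in>L. a < F x \<and> F x < b)"
    and B: "B \<in> sets lebesgue" "\<not> negligible B"
    and invar: "\<forall>F\<in>L. \<forall>t. F t \<in> B \<longleftrightarrow> t \<in> B"
begin

text \<open>By density the preimages of the interval under \<open>L\<close> cover the line, and
  Lindelof extracts a countable cover. If \<open>B\<close> were null in the interval, invariance
  would make it null in each preimage, hence everywhere.\<close>

lemma not_negligible_Int_interval:
  assumes "a < b" shows "\<not> negligible (B \<inter> {a<..<b})"
proof
  assume neg: "negligible (B \<inter> {a<..<b})"
  let ?U = "(\<lambda>F. F -` {a<..<b}) ` L"
  have "open S" if "S \<in> ?U" for S
    using that increasing_diff_continuous[OF diff]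
    by (auto intro!: open_vimage continuous_on_imp_continuous_within)
  then obtain U where U: "U \<subseteq> ?U" "countable U" "\<Union>U = \<Union>?U"
    by (metis Lindelof)
  have UN: "\<Union>U = UNIV" unfolding U(3) using dense assms by fastforce
  have "negligible (B \<inter> S)" if S: "S \<in> U" for S
  proof -
    obtain F where F: "F \<in> L" "S = F -` {a<..<b}" using S U(1) by blast
    obtain H where H: "H \<in> L" "\<And>t. H (F t) = t" using inverse[OF F(1)] by blast
    have "B \<inter> S \<subseteq> H ` (B \<inter> {a<..<b})"
    proof
      fix t assume t: "t \<in> B \<inter> S"
      then have "F t \<in> B \<inter> {a<..<b}" using invar F by auto
      then show "t \<in> H ` (B \<inter> {a<..<b})" using H(2)[of t] by force
    qed
    then show ?thesis using negligible_image[OF H(1) neg] negligible_subset by blast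
  qed
  then have "negligible (\<Union>S\<in>U. B \<inter> S)"
    using U(2) by (intro negligible_countable_Union) auto
  moreover have "(\<Union>S\<in>U. B \<inter> S) = B" using UN by blast
  ultimately show False using B(2) by simp
qed

text \<open>Every ball of radius \<open>\<rho>\<close> contains, after translation by a multiple of
  the period, a ball of radius \<open>\<rho> / 2\<close> about one of finitely many points, each of
  positive mass in \<open>B\<close>.\<close>

lemma uniform_mass:
  assumes "0 < \<rho>"
  obtains \<eta> where "0 < \<eta>" "\<And>t. \<eta> \<le> measure lebesgue (B \<inter> ball t \<rho>)"
proof -
  let ?m = "\<lambda>t r. measure lebesgue (B \<inter> ball t r)"
  have meas: "B \<inter> ball t r \<in> lmeasurable" for t r
    using B(1) by (rule lmeasurable_Int_ball)
  have pos: "0 < ?m t r" if "0 < r" for t r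
  proof -
    have "\<not> negligible (B \<inter> ball t r)"
      using not_negligible_Int_interval[of "t - r" "t + r"] that by (simp add: ball_eq_greaterThanLessThan)
    then show ?thesis using negligible_iff_measure0[OF meas] zero_less_measure_iff by blast
  qed
  have "{0..2 * pi} \<subseteq> (\<Union>y\<in>{0..2 * pi}. ball y (\<rho> / 2))" using assms by force
  then obtain Y where Y: "finite Y" "{0..2 * pi} \<subseteq> (\<Union>y\<in>Y. ball y (\<rho> / 2))"
    by (rule compactE_image[OF compact_Icc _, rotated]) auto
  then have "Y \<noteq> {}" by fastforce
  define \<eta> where "\<eta> = Min ((\<lambda>y. ?m y (\<rho> / 2)) ` Y)"
  show ?thesis
  proof (rule that)
    show "0 < \<eta>" using Y(1) \<open>Y \<noteq> {}\<close> pos assms by (simp add: \<eta>_def)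
    fix t
    obtain k :: int where k: "0 \<le> t + 2 * pi * of_int k" "t + 2 * pi * of_int k < 2 * pi"
      by (rule reduce_mod_period)
    define s where "s = t + 2 * pi * of_int k"
    obtain y where y: "y \<in> Y" "dist y s < \<rho> / 2" using Y(2) k by (force simp: s_def)
    have "ball y (\<rho> / 2) \<subseteq> ball s \<rho>"
    proof
      fix u assume "u \<in> ball y (\<rho> / 2)"
      with y(2) dist_triangle[of s u y] show "u \<in> ball s \<rho>" by (simp add: dist_commute)
    qed
    then have "?m y (\<rho> / 2) \<le> ?m s \<rho>"
      using meas by (intro measure_mono_fmeasurable) (auto simp: fmeasurableD)
    then have "\<eta> \<le> ?m s \<rho>"
      using Y(1) y(1) unfolding \<eta>_def by (meson Min_le finite_imageI imageI order_trans)
    also have "B \<inter> ball s \<rho> = (+) (2 * pi * of_int k) ` (B \<inter> ball t \<rho>)"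
    proof (intro equalityI subsetI)
      fix u assume u: "u \<in> B \<inter> ball s \<rho>"
      have "u - 2 * pi * of_int k \<in> B"
        using u bspec[OF invar translation[of k], THEN spec, of "u - 2 * pi * of_int k"] by simp
      moreover have "u - 2 * pi * of_int k \<in> ball t \<rho>" using u by (auto simp: s_def dist_real_def)
      ultimately show "u \<in> (+) (2 * pi * of_int k) ` (B \<inter> ball t \<rho>)"
        by (intro image_eqI[of _ _ "u - 2 * pi * of_int k"]) auto
    next
      fix u assume "u \<in> (+) (2 * pi * of_int k) ` (B \<inter> ball t \<rho>)"
      then obtain v where v: "u = v + 2 * pi * of_int k" "v \<in> B" "v \<in> ball t \<rho>"
        by (auto simp: add.commute)
      then show "u \<in> B \<inter> ball s \<rho>"
        using bspec[OF invar translation[of k], THEN spec, of v] by (auto simp: s_def dist_real_def)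
    qed
    also have "measure lebesgue \<dots> = ?m t \<rho>" by (rule measure_translation)
    finally show "\<eta> \<le> ?m t \<rho>" .
  qed
qed

end

end

context star_line_action
begin

text \<open>\<open>F\<close> carries the \<open>\<delta>\<close>-ball at \<open>x\<close> over the
  \<open>\<rho>\<close>-ball at \<open>F x\<close>, where \<open>B\<close> has mass at least
  \<open>\<eta>\<close>. Pulled back with bounded distortion, this gives \<open>B\<close> a fixed
  share of the \<open>\<delta>\<close>-ball, so \<open>A\<close> is thin at
  \<open>x\<close>.\<close>

lemma line_ergodic:
  assumes dense: "\<forall>x a b. a < b \<longrightarrow> (\<exists>F\<in>L. a < F x \<and> F x < b)"
    and exceptional: "negligible {x. \<exists>F\<in>L. F x \<in> nonexp}"
    and A: "A \<in> sets lebesgue" and invar: "\<forall>F\<in>L. \<forall>t. F t \<in> A \<longleftrightarrow> t \<in> A"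
  shows "negligible A \<or> negligible (- A)"
proof (rule disjCI)
  assume nB: "\<not> negligible (- A)"
  let ?m = "measure lebesgue"
  define B where "B = - A"
  have B: "B \<in> sets lebesgue" "\<not> negligible B"
    using sets.compl_sets[OF A] nB by (auto simp: B_def Compl_eq_Diff_UNIV)
  have invB: "\<forall>F\<in>L. \<forall>t. F t \<in> B \<longleftrightarrow> t \<in> B" using invar by (simp add: B_def)
  obtain C where C: "0 < C"
    "\<And>x M. (\<And>F. F \<in> L \<Longrightarrow> F x \<notin> nonexp) \<Longrightarrow> \<exists>F\<in>L. distortion_le F x (C * D F x) \<and> M \<le> D F x"
    using unbounded_expansion by blast
  obtain \<kappa> where \<kappa>: "1 \<le> \<kappa>" "\<And>F t. F \<in> L \<Longrightarrow> D F t \<le> \<kappa> * deriv F t"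
    "\<And>F t. F \<in> L \<Longrightarrow> deriv F t \<le> \<kappa> * D F t"
    using D_deriv_comparable by blast
  \<comment> \<open>A radius covered by every image: \<open>exp (- 1) * deriv F x * \<delta>\<close>
    with \<open>\<delta> = 1 / (C * D F x)\<close> is at least this, because
    \<open>D F x \<le> \<kappa> * deriv F x\<close>.\<close>
  define \<rho> where "\<rho> = exp (- 1) / (C * \<kappa>)"
  have \<rho>: "0 < \<rho>" using C(1) \<kappa>(1) by (simp add: \<rho>_def)
  obtain \<eta> where \<eta>: "0 < \<eta>" "\<And>t. \<eta> \<le> ?m (B \<inter> ball t \<rho>)"
    using uniform_mass[OF dense B invB \<rho>] by blast
  \<comment> \<open>Pulling back divides the mass \<open>\<eta>\<close> by at most
    \<open>exp 1 * \<kappa> * D F x\<close>; relative to the length \<open>2 * \<delta>\<close> this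
    leaves the share \<open>c\<close>.\<close>
  define c where "c = \<eta> * C / (2 * exp 1 * \<kappa>)"
  have c: "0 < c" using \<eta> C \<kappa> by (simp add: c_def)
  show "negligible A"
  proof (rule negligible_if_thin[OF A _ _ exceptional, of "min c 1"])
    fix x d :: real
    assume x: "x \<in> A - {x. \<exists>F\<in>L. F x \<in> nonexp}" and d: "0 < d"
    \<comment> \<open>The derivative demanded makes the radius \<open>\<delta>\<close> at most
      \<open>d / 2\<close>.\<close>
    then obtain F where F: "F \<in> L" "distortion_le F x (C * D F x)" "2 / (C * d) \<le> D F x"
      using C(2)[of x "2 / (C * d)"] by auto
    define \<delta> where "\<delta> = 1 / (C * D F x)"
    note Dpos = D_pos[OF F(1), of x] and dpos = deriv_pos[OF F(1)] and Fd = diff[OF F(1)]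
    have \<delta>: "0 < \<delta>" using C(1) Dpos by (simp add: \<delta>_def)
    have "2 \<le> C * D F x * d" using F(3) C(1) d by (simp add: divide_le_eq mult_ac)
    then have "\<delta> < d" using C(1) Dpos by (simp add: \<delta>_def divide_less_eq mult_ac)
    have near: "C * D F x * \<bar>u - x\<bar> \<le> 1" if "\<bar>u - x\<bar> \<le> \<delta>" for u
      using mult_left_mono[OF that, of "C * D F x"] C(1) Dpos by (simp add: \<delta>_def)
    have "\<rho> \<le> exp (- 1) * deriv F x * \<delta>"
    proof -
      have "1 / (C * \<kappa>) \<le> deriv F x * \<delta>"
        using \<kappa>(2)[OF F(1), of x] C(1) Dpos \<kappa>(1) by (simp add: \<delta>_def field_simps)
      then show ?thesis
        unfolding \<rho>_def using mult_left_mono[of "1 / (C * \<kappa>)" "deriv F x * \<delta>" "exp (- 1)"] by (simp add: mult_ac)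
    qed
    then have far: "\<rho> \<le> \<bar>F u - F x\<bar>" if "\<bar>u - x\<bar> = \<delta>" for u
      using distortion_le_dist(1)[OF Fd F(2) near[of u]] that by simp
    have mono: "strict_mono F" using Fd by (rule increasing_diff_strict_mono)
    have lo: "F (x - \<delta>) \<le> F x - \<rho>"
      using far[of "x - \<delta>"] strict_monoD[OF mono, of "x - \<delta>" x] \<delta> by simp
    have hi: "F x + \<rho> \<le> F (x + \<delta>)"
      using far[of "x + \<delta>"] strict_monoD[OF mono, of x "x + \<delta>"] \<delta> by simp
    obtain H where H: "H \<in> L" "\<And>t. F (H t) = t" using inverse[OF F(1)] by blast
    define E where "E = B \<inter> ball x \<delta>"
    have sub: "B \<inter> ball (F x) \<rho> \<subseteq> F ` E"
    proof
      fix u assume u: "u \<in> B \<inter> ball (F x) \<rho>"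
      then have "F (x - \<delta>) < F (H u)" "F (H u) < F (x + \<delta>)"
        using lo hi by (auto simp: H(2) ball_eq_greaterThanLessThan)
      then have "H u \<in> ball x \<delta>"
        using mono by (simp add: strict_mono_less ball_eq_greaterThanLessThan)
      moreover have "H u \<in> B" using invB H(1) u by auto
      ultimately show "u \<in> F ` E" using H(2)[of u] unfolding E_def by force
    qed
    have Es: "E \<in> sets lebesgue" "bounded E" using B(1) by (auto simp: E_def)
    have EM: "deriv F t \<le> exp 1 * deriv F x" if "t \<in> E" for t
      using that by (intro distortion_le_deriv(2)[OF Fd F(2)] near) (auto simp: E_def dist_real_def)
    have im: "F ` E \<in> lmeasurable" "?m (F ` E) \<le> exp 1 * deriv F x * ?m E"
      using measure_increasing_image_le[OF Fd Es, of "exp 1 * deriv F x"] EM by blast+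
    have "?m (B \<inter> ball (F x) \<rho>) \<le> ?m (F ` E)"
      using sub fmeasurableD[OF lmeasurable_Int_ball[OF B(1)]] im(1)
      by (intro measure_mono_fmeasurable) auto
    with \<eta>(2)[of "F x"] have "\<eta> \<le> ?m (F ` E)" by linarith
    also have "\<dots> \<le> exp 1 * deriv F x * ?m E" by (rule im)
    also have "\<dots> \<le> exp 1 * (\<kappa> * D F x) * ?m E"
      using \<kappa>(3)[OF F(1), of x] by (intro mult_right_mono mult_left_mono) auto
    finally have "\<eta> / (exp 1 * \<kappa> * D F x) \<le> ?m E"
      using \<kappa>(1) Dpos by (simp add: divide_le_eq mult_ac)
    moreover have "\<eta> / (exp 1 * \<kappa> * D F x) = c * (2 * \<delta>)"
      using C(1) Dpos \<kappa>(1) by (simp add: c_def \<delta>_def field_simps)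
    ultimately have mE: "c * (2 * \<delta>) \<le> ?m E" by simp
    have ball: "?m (ball x \<delta>) = 2 * \<delta>" using \<delta> by (simp add: ball_eq_greaterThanLessThan)
    have "A \<inter> ball x \<delta> = ball x \<delta> - E" by (auto simp: E_def B_def)
    then have "?m (A \<inter> ball x \<delta>) = ?m (ball x \<delta>) - ?m E"
      using Es by (simp add: measurable_measure_Diff E_def)
    also have "\<dots> \<le> 2 * \<delta> - min c 1 * (2 * \<delta>)"
      using mE ball \<delta> mult_right_mono[of "min c 1" c "2 * \<delta>"] by linarith
    finally have "?m (A \<inter> ball x \<delta>) \<le> (1 - min c 1) * ?m (ball x \<delta>)"
      by (simp add: ball algebra_simps)
    with \<delta> \<open>\<delta> < d\<close> show "\<exists>r. 0 < r \<and> r < d \<and> ?m (A \<inter> ball x r) \<le> (1 - min c 1) * ?m (ball x r)"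
      by blast
  qed (use c in auto)
qed

end

section \<open>Lifting the action from the circle\<close>

lemma cis_eq_cis_iff: "cis a = cis b \<longleftrightarrow> (\<exists>k::int. a = b + 2 * pi * of_int k)"
proof -
  have "cis a = cis b \<longleftrightarrow> (\<exists>k::int. \<i> * of_real a = \<i> * of_real b + of_real (of_int (2 * k) * pi) * \<i>)"
    unfolding cis_conv_exp by (rule exp_eq)
  also have "\<dots> \<longleftrightarrow> (\<exists>k::int. a = b + 2 * pi * of_int k)"
    by (intro arg_cong[of _ _ Ex] ext) (auto simp: complex_eq_iff algebra_simps)
  finally show ?thesis .
qed

lemma cis_shift: "cis (t + 2 * pi * of_int k) = cis t"
  using cis_eq_cis_iff by blast

lemma circle_cis: "z \<in> circle \<Longrightarrow> \<exists>t. z = cis t"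
  using cis_Arg[of z] by (intro exI[of _ "Arg z"]) (force simp: sgn_eq)

lemma cis_in_circle [simp]: "cis t \<in> circle"
  by simp

lemma has_vector_derivative_cis:
  assumes "(f has_real_derivative d) (at t)"
  shows "((\<lambda>t. cis (f t)) has_vector_derivative d *\<^sub>R (\<i> * cis (f t))) (at t)"
  using has_derivative_cis[OF assms[unfolded has_field_derivative_def]]
  by (simp add: has_vector_derivative_def mult.commute)

lemma angular_deriv_lift:
  assumes lift: "\<And>t. cis (F t) = g (cis t)" and F: "(F has_real_derivative d) (at s)"
  shows "angular_deriv g (cis s) = d"
proof -
  have eq: "(\<lambda>t. g (cis s * cis t)) = (\<lambda>t. cis (F (s + t)))"
    by (simp add: lift cis_mult)
  have "((\<lambda>t. F (s + t)) has_real_derivative d) (at 0)"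
    using F DERIV_shift[of F d 0 s] by (simp add: add.commute)
  from has_vector_derivative_cis[OF this]
  have "((\<lambda>t. cis (F (s + t))) has_vector_derivative d *\<^sub>R (\<i> * cis (F s))) (at 0)"
    by simp
  then have "vector_derivative (\<lambda>t. g (cis s * cis t)) (at 0) = d *\<^sub>R (\<i> * cis (F s))"
    unfolding eq by (rule vector_derivative_at)
  then show ?thesis unfolding angular_deriv_def lift[symmetric] by (simp add: scaleR_conv_of_real)
qed

lemma antiderivative_on_line:
  fixes a :: "real \<Rightarrow> real"
  assumes "continuous_on UNIV a"
  obtains F where "\<And>t. (F has_real_derivative a t) (at t)"
proof -
  have "isCont a t" for t using assms by (simp add: continuous_on_eq_continuous_at)
  then obtain F where "\<forall>x. (F has_vector_derivative a x) (at x)"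
    using einterval_antiderivative[of "- \<infinity>" "\<infinity>" a] by auto
  then show ?thesis
    using that[of F] by (simp add: has_real_derivative_iff_has_vector_derivative)
qed

text \<open>The lift comes from integration. A curve \<open>\<gamma>\<close> of unit modulus has
  velocity \<open>\<i> * a t * \<gamma> t\<close> with real \<open>a\<close>, so for an
  antiderivative \<open>F\<close> of \<open>a\<close> the product
  \<open>\<gamma> t * cis (- F t)\<close> is constant. The value \<open>z\<close> selects the
  branch, which later allows lifts to be normalised at a point.\<close>

lemma C2_circle_map_lift:
  assumes g: "C2_circle_map g" and yz: "g (cis y) = cis z"
  obtains F a a' where "F y = z" "\<And>t. cis (F t) = g (cis t)"
    "\<And>t. (F has_real_derivative a t) (at t)"
    "\<And>t. (a has_real_derivative a' t) (at t)" "continuous_on UNIV a'"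
proof -
  define \<gamma> where "\<gamma> t = g (cis t)" for t
  obtain D where D: "\<And>t. (\<gamma> has_vector_derivative D t) (at t)" "D C1_differentiable_on UNIV"
    using g unfolding C2_circle_map_def \<gamma>_def by blast
  obtain E where E: "\<And>t. (D has_vector_derivative E t) (at t)" "continuous_on UNIV E"
    using D(2) unfolding C1_differentiable_on_def by blast
  have "norm (\<gamma> t) = 1" for t
    using g cis_in_circle[of t] unfolding C2_circle_map_def \<gamma>_def by (auto simp: image_subset_iff)
  then have unit: "\<gamma> t * cnj (\<gamma> t) = 1" for t
    unfolding complex_norm_square[symmetric] by simp
  have cD: "continuous_on UNIV D"
    by (rule continuous_on_vector_derivative[OF has_vector_derivative_at_within[OF E(1)]])
  have c\<gamma>: "continuous_on UNIV \<gamma>"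
    by (rule continuous_on_vector_derivative[OF has_vector_derivative_at_within[OF D(1)]])
  define a where "a t = Im (D t * cnj (\<gamma> t))" for t
  define a' where "a' t = Im (D t * cnj (D t) + E t * cnj (\<gamma> t))" for t
  have "((\<lambda>t. D t * cnj (\<gamma> t)) has_vector_derivative D t * cnj (D t) + E t * cnj (\<gamma> t)) (at t)" for t
    by (intro has_vector_derivative_mult has_vector_derivative_cnj D E)
  then have a': "(a has_real_derivative a' t) (at t)" for t
    unfolding has_real_derivative_iff_has_vector_derivative a_def a'_def
    by (rule bounded_linear.has_vector_derivative[OF bounded_linear_Im])
  have ca: "continuous_on UNIV a"
    unfolding a_def by (intro continuous_intros cD c\<gamma>)
  have ca': "continuous_on UNIV a'"
    unfolding a'_def by (intro continuous_intros cD c\<gamma> E)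
  \<comment> \<open>Differentiating \<open>\<gamma> t * cnj (\<gamma> t) = 1\<close> kills the real
    part of \<open>D t * cnj (\<gamma> t)\<close>.\<close>
  have D_eq: "D t = \<i> * a t * \<gamma> t" for t
  proof -
    have "((\<lambda>t. \<gamma> t * cnj (\<gamma> t)) has_vector_derivative \<gamma> t * cnj (D t) + D t * cnj (\<gamma> t)) (at t)"
      by (intro has_vector_derivative_mult has_vector_derivative_cnj D)
    moreover have "((\<lambda>t. \<gamma> t * cnj (\<gamma> t)) has_vector_derivative 0) (at t)"
      by (simp add: unit)
    ultimately have "\<gamma> t * cnj (D t) + D t * cnj (\<gamma> t) = 0"
      using vector_derivative_unique_at by blast
    then have "Re (D t * cnj (\<gamma> t)) = 0"
      by (simp add: complex_eq_iff)
    then have "D t * cnj (\<gamma> t) = \<i> * a t" by (simp add: a_def complex_eq_iff)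
    then have "D t * (\<gamma> t * cnj (\<gamma> t)) = \<i> * a t * \<gamma> t" by (simp add: mult_ac)
    then show ?thesis by (simp add: unit)
  qed
  obtain F0 where F0: "\<And>t. (F0 has_real_derivative a t) (at t)"
    using antiderivative_on_line[OF ca] by blast
  define F where "F t = F0 t - F0 y + z" for t
  have F: "(F has_real_derivative a t) (at t)" for t
    unfolding F_def by (auto intro!: derivative_eq_intros F0)
  have "((\<lambda>t. \<gamma> t * cis (- F t)) has_vector_derivative
      \<gamma> t * ((- a t) *\<^sub>R (\<i> * cis (- F t))) + D t * cis (- F t)) (at t)" for t
    by (intro has_vector_derivative_mult D has_vector_derivative_cis DERIV_minus F)
  then have "((\<lambda>t. \<gamma> t * cis (- F t)) has_vector_derivative 0) (at t)" for t
    by (simp add: D_eq scaleR_conv_of_real mult_ac)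
  then have "((\<lambda>t. \<gamma> t * cis (- F t)) has_derivative (\<lambda>h. 0)) (at t)" for t
    by (simp add: has_vector_derivative_def)
  then have "\<gamma> t * cis (- F t) = \<gamma> y * cis (- F y)" for t
    using has_derivative_zero_unique[OF convex_UNIV, of "\<lambda>t. \<gamma> t * cis (- F t)" t y] by simp
  then have "\<gamma> t * cis (- F t) = 1" for t
    by (simp add: F_def \<gamma>_def yz cis_mult)
  then have "\<gamma> t * (cis (- F t) * cis (F t)) = cis (F t)" for t
    by (simp add: mult.assoc[symmetric])
  then have "cis (F t) = g (cis t)" for t by (simp add: cis_mult \<gamma>_def)
  moreover have "F y = z" by (simp add: F_def)
  ultimately show ?thesis using that F a' ca' by blast
qed

section \<open>The group of all lifts and its regularity\<close>

lemma periodic_C1_lipschitz: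
  fixes f :: "real \<Rightarrow> real"
  assumes f: "\<And>t. (f has_real_derivative f' t) (at t)" and f': "continuous_on UNIV f'"
    and per: "\<And>t (k::int). f (t + 2 * pi * of_int k) = f t"
  shows "\<exists>q\<ge>0. \<forall>s t. \<bar>f s - f t\<bar> \<le> q * \<bar>s - t\<bar>"
proof -
  have per': "f' (t + 2 * pi * of_int k) = f' t" for t and k :: int
  proof -
    have "(f has_real_derivative f' (t + 2 * pi * of_int k)) (at t)"
      using f[of "t + 2 * pi * of_int k"] unfolding DERIV_shift per .
    then show ?thesis using f DERIV_unique by blast
  qed
  have ne: "{0..2 * pi} \<noteq> {}" by simp
  have c: "continuous_on {0..2 * pi} (\<lambda>t. \<bar>f' t\<bar>)"
    using f' by (intro continuous_intros continuous_on_subset[OF f']) auto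
  obtain s where s: "\<And>t. t \<in> {0..2 * pi} \<Longrightarrow> \<bar>f' t\<bar> \<le> \<bar>f' s\<bar>"
    using continuous_attains_sup[OF compact_Icc ne c] by blast
  have b: "norm (f' t) \<le> \<bar>f' s\<bar>" for t
  proof -
    obtain k :: int where "0 \<le> t + 2 * pi * of_int k" "t + 2 * pi * of_int k < 2 * pi"
      by (rule reduce_mod_period)
    then show ?thesis using s[of "t + 2 * pi * of_int k"] by (simp add: per')
  qed
  have "norm (f t - f u) \<le> \<bar>f' s\<bar> * norm (t - u)" for t u
    by (rule field_differentiable_bound[OF convex_UNIV _ b]) (use f has_field_derivative_at_within in auto)
  then show ?thesis by (intro exI[of _ "\<bar>f' s\<bar>"]) auto
qed

text \<open>Differentiability excludes functions that jump by multiples of the period; finer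
  regularity is inherited from the circle maps. The lifts of the identity supply the
  translations.\<close>

definition lifts :: "(complex \<Rightarrow> complex) set \<Rightarrow> (real \<Rightarrow> real) set" where
  "lifts G = {F. (\<forall>t. \<exists>d. (F has_real_derivative d) (at t)) \<and> (\<exists>g\<in>G. \<forall>t. cis (F t) = g (cis t))}"

lemma lifts_deriv:
  assumes "F \<in> lifts G" "\<And>t. cis (F t) = g (cis t)"
  shows "(F has_real_derivative angular_deriv g (cis t)) (at t)"
proof -
  obtain d where "(F has_real_derivative d) (at t)" using assms(1) unfolding lifts_def by blast
  with angular_deriv_lift[where F = F and g = g, OF assms(2)] show ?thesis by simp
qed

lemma lift_exists:
  assumes "G \<subseteq> Diff2_plus" "g \<in> G" "g (cis y) = cis z"
  obtains F where "F \<in> lifts G" "F y = z" "\<And>t. cis (F t) = g (cis t)"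
proof -
  have "C2_circle_map g" using assms by (auto simp: Diff2_plus_def)
  from C2_circle_map_lift[OF this assms(3)] obtain F a where
    F: "F y = z" "\<And>t. cis (F t) = g (cis t)" "\<And>t. (F has_real_derivative a t) (at t)"
    by metis
  then have "F \<in> lifts G" using assms(2) unfolding lifts_def by blast
  with F show ?thesis using that by blast
qed

text \<open>Membership of \<open>F\<close> in \<open>lifts G\<close> provides mere
  differentiability. The lift \<open>F'\<close> of the same \<open>g\<close> has a C1 derivative,
  and both derivatives equal \<open>angular_deriv g\<close>, so the regularity passes to
  \<open>F\<close>.\<close>

lemma lifts_log_lipschitz:
  assumes G: "G \<subseteq> Diff2_plus" and F: "F \<in> lifts G"
  shows "\<exists>q\<ge>0. \<forall>s t. \<bar>ln (deriv F s) - ln (deriv F t)\<bar> \<le> q * \<bar>s - t\<bar>"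
proof -
  obtain g where g: "g \<in> G" "\<And>t. cis (F t) = g (cis t)" using F unfolding lifts_def by blast
  have dF: "deriv F t = angular_deriv g (cis t)" for t
    using lifts_deriv[where g = g, OF F g(2)] DERIV_imp_deriv by blast
  have pos: "0 < angular_deriv g (cis t)" for t
    using G g(1) cis_in_circle[of t] by (auto simp: Diff2_plus_def)
  have "C2_circle_map g" using G g(1) by (auto simp: Diff2_plus_def)
  moreover have "g (cis 0) = cis (F 0)" using g(2)[of 0] by simp
  ultimately obtain F' a a' where F': "\<And>t. cis (F' t) = g (cis t)"
    "\<And>t. (F' has_real_derivative a t) (at t)"
    "\<And>t. (a has_real_derivative a' t) (at t)" "continuous_on UNIV a'"
    using C2_circle_map_lift by metis
  have a: "angular_deriv g (cis t) = a t" for t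
    by (rule angular_deriv_lift[where g = g and F = F', OF F'(1,2)])
  have apos: "0 < a t" for t using pos[of t] a by simp
  have "continuous_on UNIV a"
    using F'(3) by (meson DERIV_continuous_on has_field_derivative_at_within)
  then have "continuous_on UNIV (\<lambda>t. 1 / a t * a' t)"
    using apos F'(4) by (intro continuous_intros) (auto simp: less_imp_neq[symmetric])
  moreover have "((\<lambda>t. ln (a t)) has_real_derivative 1 / a t * a' t) (at t)" for t
    using apos[of t] by (auto intro!: derivative_eq_intros F'(3))
  moreover have "ln (a (t + 2 * pi * of_int k)) = ln (a t)" for t k
    unfolding a[symmetric] cis_shift ..
  ultimately have "\<exists>q\<ge>0. \<forall>s t. \<bar>ln (a s) - ln (a t)\<bar> \<le> q * \<bar>s - t\<bar>"
    by (intro periodic_C1_lipschitz)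
  then show ?thesis by (simp add: dF a)
qed

lemma lifts_line_action:
  assumes h: "riemannian_metric h" and sub: "subgroup G (BijGroup circle)" and G: "G \<subseteq> Diff2_plus"
  shows "line_action (lifts G) (\<lambda>t. sqrt (h (cis t)))"
proof -
  have bij: "g \<in> Bij circle" if "g \<in> G" for g using that G by (auto simp: Diff2_plus_def)
  have diff: "increasing_diff F" if F: "F \<in> lifts G" for F
  proof -
    obtain g where g: "g \<in> G" "\<And>t. cis (F t) = g (cis t)" using F unfolding lifts_def by blast
    have "0 < angular_deriv g (cis t)" for t
      using G g(1) cis_in_circle[of t] by (auto simp: Diff2_plus_def)
    then show ?thesis
      unfolding increasing_diff_def using lifts_deriv[where g = g, OF F g(2)] by blast
  qed
  have one: "(\<lambda>x\<in>circle. x) \<in> G"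
    using subgroup.one_closed[OF sub] by (simp add: BijGroup_def)
  have hpos: "0 < h (cis t)" for t using h cis_in_circle unfolding riemannian_metric_def by blast
  show ?thesis
  proof
    fix F H assume F: "F \<in> lifts G" and H: "H \<in> lifts G"
    obtain f where f: "f \<in> G" "\<And>t. cis (F t) = f (cis t)" using F unfolding lifts_def by blast
    obtain k where k: "k \<in> G" "\<And>t. cis (H t) = k (cis t)" using H unfolding lifts_def by blast
    have "f \<otimes>\<^bsub>BijGroup circle\<^esub> k \<in> G" by (rule subgroup.m_closed[OF sub f(1) k(1)])
    then have "compose circle f k \<in> G" using bij f(1) k(1) by (simp add: BijGroup_def)
    moreover have "cis ((F \<circ> H) t) = compose circle f k (cis t)" for t
      by (simp add: compose_def f(2) k(2)[symmetric])
    moreover have "\<exists>d. ((F \<circ> H) has_real_derivative d) (at t)" for t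
      using increasing_diff_comp(1)[OF diff[OF F] diff[OF H]] increasing_diffD(1) by blast
    ultimately show "F \<circ> H \<in> lifts G" unfolding lifts_def by blast
  next
    fix F assume F: "F \<in> lifts G"
    obtain f where f: "f \<in> G" "\<And>t. cis (F t) = f (cis t)" using F unfolding lifts_def by blast
    define k where "k = (\<lambda>x\<in>circle. inv_into circle f x)"
    have kG: "k \<in> G"
      using subgroup.m_inv_closed[OF sub f(1)] inv_BijGroup[OF bij[OF f(1)]] by (simp add: k_def)
    have inj: "inj_on f circle" using bij[OF f(1)] by (simp add: Bij_def bij_betw_def)
    have kf: "k (cis (F t)) = cis t" for t
      using inv_into_f_f[OF inj cis_in_circle, of t] by (simp add: k_def f(2)[symmetric])
    \<comment> \<open>The lift of the inverse is normalised at \<open>F 0\<close>, so that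
      \<open>H \<circ> F\<close>, a lift of the identity and hence of derivative 1, fixes 0.\<close>
    obtain H where H: "H \<in> lifts G" "H (F 0) = 0" "\<And>t. cis (H t) = k (cis t)"
      using lift_exists[OF G kG kf[of 0]] by metis
    have HF: "increasing_diff (H \<circ> F)" by (rule increasing_diff_comp(1)[OF diff[OF H(1)] diff[OF F]])
    have "((H \<circ> F) has_real_derivative 1) (at t)" for t
    proof -
      have "angular_deriv id (cis t) = deriv (H \<circ> F) t"
        by (rule angular_deriv_lift[OF _ increasing_diffD(1)[OF HF]]) (simp add: H(3) kf)
      moreover have "angular_deriv id (cis t) = 1"
        by (rule angular_deriv_lift[of "\<lambda>t. t"]) (auto intro!: derivative_eq_intros)
      ultimately show ?thesis using increasing_diffD(1)[OF HF, of t] by simp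
    qed
    then have "((\<lambda>t. (H \<circ> F) t - t) has_real_derivative 1 - 1) (at t)" for t
      by (intro DERIV_diff DERIV_ident)
    then have "((\<lambda>t. (H \<circ> F) t - t) has_real_derivative 0) (at t)" for t by simp
    then have "(H \<circ> F) t - t = (H \<circ> F) 0 - 0" for t
      using DERIV_isconst_all by blast
    then have HF_id: "H (F t) = t" for t using H(2) by simp
    moreover have "F (H t) = t" for t
    proof -
      have "H (F (H t)) = H t" by (rule HF_id)
      then show ?thesis
        using strict_mono_eq[OF increasing_diff_strict_mono[OF diff[OF H(1)]]] by blast
    qed
    ultimately show "\<exists>H\<in>lifts G. (\<forall>t. H (F t) = t) \<and> (\<forall>t. F (H t) = t)" using H(1) by blast
  next
    fix k :: int
    have "cis (t + 2 * pi * of_int k) = (\<lambda>x\<in>circle. x) (cis t)" for t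
      by (simp add: cis_shift)
    moreover have "\<exists>d. ((\<lambda>t. t + 2 * pi * of_int k) has_real_derivative d) (at t)" for t
      by (rule exI[of _ 1]) (auto intro!: derivative_eq_intros)
    ultimately show "(\<lambda>t. t + 2 * pi * of_int k) \<in> lifts G"
      unfolding lifts_def using one by blast
  next
    have "(deriv ^^ 0) (\<lambda>t. h (cis t)) differentiable_on UNIV"
      using h unfolding riemannian_metric_def by blast
    then have "continuous_on UNIV (\<lambda>t. h (cis t))"
      using differentiable_imp_continuous_on by simp
    then show "continuous_on UNIV (\<lambda>t. sqrt (h (cis t)))" by (intro continuous_intros)
  qed (use diff hpos lifts_log_lipschitz[OF G] in \<open>auto simp: cis_shift\<close>)
qed

section \<open>Countability, null sets and the measure on the circle\<close>

lemma generate_countable: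
  assumes "countable S" shows "countable (generate M S)"
proof -
  \<comment> \<open>Each level adds the products of two elements of the previous one; the levels
    increase, so two factors always lie in a common one.\<close>
  define X where "X = rec_nat (insert \<one>\<^bsub>M\<^esub> (S \<union> m_inv M ` S)) (\<lambda>_ A. A \<union> (\<lambda>(x, y). x \<otimes>\<^bsub>M\<^esub> y) ` (A \<times> A))"
  have X0: "X 0 = insert \<one>\<^bsub>M\<^esub> (S \<union> m_inv M ` S)"
    and XS: "X (Suc n) = X n \<union> (\<lambda>(x, y). x \<otimes>\<^bsub>M\<^esub> y) ` (X n \<times> X n)" for n
    by (simp_all add: X_def)
  have "countable (X n)" for n
    by (induction n) (use assms in \<open>auto simp: X0 XS\<close>)
  then have "countable (\<Union>n. X n)" by simp
  moreover have mono: "X m \<subseteq> X n" if "m \<le> n" for m n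
    by (rule lift_Suc_mono_le[OF _ that]) (auto simp: XS)
  have "x \<in> (\<Union>n. X n)" if "x \<in> generate M S" for x
    using that
  proof induction
    case (eng x y)
    then obtain m n where "x \<in> X m" "y \<in> X n" by auto
    then have "x \<in> X (max m n)" "y \<in> X (max m n)" using mono by (meson max.cobounded1 max.cobounded2 subsetD)+
    then have "x \<otimes>\<^bsub>M\<^esub> y \<in> X (Suc (max m n))" unfolding XS by blast
    then show ?case by blast
  qed (use X0 in blast)+
  ultimately show ?thesis by (meson countable_subset subsetI)
qed

lemma countable_vimage_cis:
  assumes "countable Y" shows "countable (cis -` Y)"
proof -
  have "cis -` {z} \<subseteq> range (\<lambda>k::int. (SOME t. cis t = z) + 2 * pi * of_int k)" for z
  proof
    fix t assume "t \<in> cis -` {z}"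
    then have z: "cis t = z" by simp
    then have "cis (SOME t. cis t = z) = z" by (rule someI)
    with z have "cis t = cis (SOME t. cis t = z)" by simp
    then show "t \<in> range (\<lambda>k::int. (SOME t. cis t = z) + 2 * pi * of_int k)"
      unfolding cis_eq_cis_iff by blast
  qed
  then have "countable (cis -` {z})" for z
    using countable_subset by blast
  then have "countable (\<Union>z\<in>Y. cis -` {z})" using assms by blast
  moreover have "cis -` Y = (\<Union>z\<in>Y. cis -` {z})" by blast
  ultimately show ?thesis by simp
qed

lemma negligible_periodic:
  assumes neg: "negligible (P \<inter> {0..<2 * pi})"
    and per: "\<And>t (k::int). t + 2 * pi * of_int k \<in> P \<longleftrightarrow> t \<in> P"
  shows "negligible P"
proof -
  have "negligible (\<Union>k::int. (+) (2 * pi * of_int k) ` (P \<inter> {0..<2 * pi}))"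
    using neg by (intro negligible_countable_Union) (auto simp: negligible_translation)
  moreover have "P \<subseteq> (\<Union>k::int. (+) (2 * pi * of_int k) ` (P \<inter> {0..<2 * pi}))"
  proof
    fix t assume t: "t \<in> P"
    obtain k :: int where k: "0 \<le> t + 2 * pi * of_int k" "t + 2 * pi * of_int k < 2 * pi"
      by (rule reduce_mod_period)
    then show "t \<in> (\<Union>k::int. (+) (2 * pi * of_int k) ` (P \<inter> {0..<2 * pi}))"
      using t per[of t k] by (intro UN_I[of "- k"] image_eqI[of _ _ "t + 2 * pi * of_int k"]) auto
  qed
  ultimately show ?thesis by (rule negligible_subset)
qed

text \<open>A set of the completion is a measurable set together with part of a null set. The
  measure sees one period of a preimage, and periodicity carries nullity to the whole line.\<close>

lemma circle_lebesgue_vimage: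
  assumes "A \<in> sets circle_lebesgue"
  shows "cis -` A \<in> sets lebesgue"
    and "negligible (cis -` A) \<Longrightarrow> emeasure circle_lebesgue A = 0"
proof -
  let ?M = "distr (restrict_space lborel {0..<2 * pi}) (restrict_space borel circle) cis"
  obtain S N N' where S: "A = S \<union> N" "N \<subseteq> N'" "N' \<in> null_sets ?M" "S \<in> sets ?M"
    using assms unfolding circle_lebesgue_def by (rule sets_completionE)
  have cis_borel: "cis \<in> borel_measurable borel"
    by (intro borel_measurable_continuous_onI continuous_intros)
  have cis_meas: "cis \<in> measurable (restrict_space lborel {0..<2 * pi}) (restrict_space borel circle)"
    using cis_borel by (intro measurable_restrict_space2 measurable_restrict_space1) auto
  have vb: "cis -` B \<in> sets borel" if "B \<in> sets ?M" for B
  proof -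
    have "B \<in> sets borel" using that by (simp add: sets_restrict_space_iff)
    then show ?thesis using measurable_sets[OF cis_borel] by simp
  qed
  have em: "emeasure ?M B = emeasure lebesgue (cis -` B \<inter> {0..<2 * pi})" if B: "B \<in> sets ?M" for B
  proof -
    have "emeasure ?M B = emeasure (restrict_space lborel {0..<2 * pi}) (cis -` B \<inter> {0..<2 * pi})"
      using B by (subst emeasure_distr[OF cis_meas]) (simp_all add: space_restrict_space)
    also have "\<dots> = emeasure lborel (cis -` B \<inter> {0..<2 * pi})"
      by (rule emeasure_restrict_space) auto
    finally show ?thesis using vb[OF B] by simp
  qed
  have N': "negligible (cis -` N')"
  proof (rule negligible_periodic)
    have "N' \<in> sets ?M" "emeasure ?M N' = 0" using S(3) by auto
    then show "negligible (cis -` N' \<inter> {0..<2 * pi})"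
      using em[of N'] vb[of N'] by (subst negligible_iff_emeasure0) auto
  qed (simp add: cis_shift)
  then have "negligible (cis -` N)" using S(2) by (meson negligible_subset vimage_mono)
  then have "cis -` S \<union> cis -` N \<in> sets lebesgue"
    using vb[OF S(4)] by (intro sets.Un) (auto simp: negligible_imp_sets)
  then show "cis -` A \<in> sets lebesgue" using S(1) by simp
  show "emeasure circle_lebesgue A = 0" if neg: "negligible (cis -` A)"
  proof -
    have "negligible (cis -` S \<inter> {0..<2 * pi})"
      by (rule negligible_subset[OF neg]) (use S(1) in auto)
    then have "emeasure ?M S = 0"
      using em[OF S(4)] vb[OF S(4)] by (subst (asm) negligible_iff_emeasure0) auto
    then have "S \<union> N' \<in> null_sets ?M" using S(3,4) by (intro null_sets.Un) auto
    then have "A \<in> null_sets (completion ?M)"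
      using S(1,2) unfolding null_sets_completion_iff2 by blast
    then show ?thesis unfolding circle_lebesgue_def by auto
  qed
qed

lemma space_circle_lebesgue: "space circle_lebesgue = circle"
  by (simp add: circle_lebesgue_def space_restrict_space)

text \<open>Rotating \<open>cis m\<close> to 1 reduces this to continuity of \<open>Arg\<close> at
  1. It converts density of orbits on the circle into density on the line.\<close>

lemma circle_near_cis:
  assumes "0 < e"
  obtains \<delta> where "0 < \<delta>" "\<And>z. z \<in> circle \<Longrightarrow> dist z (cis m) < \<delta> \<Longrightarrow> \<exists>s. \<bar>s\<bar> < e \<and> z = cis (m + s)"
proof -
  have "isCont Arg 1" by (rule continuous_at_Arg) simp
  then obtain \<delta> where \<delta>: "0 < \<delta>" "\<And>u. dist u 1 < \<delta> \<Longrightarrow> dist (Arg u) (Arg 1) < e"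
    using assms unfolding continuous_at_eps_delta by blast
  show ?thesis
  proof (rule that[OF \<delta>(1)])
    fix z assume z: "z \<in> circle" "dist z (cis m) < \<delta>"
    define u where "u = z * cis (- m)"
    have u: "norm u = 1" using z(1) by (simp add: u_def norm_mult)
    have "u - 1 = (z - cis m) * cis (- m)" by (simp add: u_def algebra_simps cis_mult)
    then have "dist u 1 < \<delta>" using z(2) by (simp add: dist_norm norm_mult)
    then have "\<bar>Arg u\<bar> < e" using \<delta>(2) by fastforce
    moreover have "cis (Arg u) = u" using u by (subst cis_Arg) (auto simp: sgn_eq)
    then have "z = cis (m + Arg u)"
      by (simp add: cis_mult[symmetric] u_def mult.left_commute) (simp add: cis_mult)
    ultimately show "\<exists>s. \<bar>s\<bar> < e \<and> z = cis (m + s)" by blast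
  qed
qed

theorem theorem1:
  fixes h :: "complex \<Rightarrow> real" and G :: "(complex \<Rightarrow> complex) set"
  assumes "riemannian_metric h"
    and "subgroup G (BijGroup circle)"
    and "G \<subseteq> Diff2_plus"
    and "finitely_generated_in (BijGroup circle) G"
    and "property_star h G"
  shows "finite (NE h G) \<and>
    (\<forall>x\<in>circle. \<not> bounded {metric_deriv h g x | g. g \<in> G} \<or> (\<exists>y\<in>NE h G. x \<in> orbit_of G y)) \<and>
    lebesgue_ergodic G"
proof -
  note sub = assms(2) and G = assms(3)
  let ?L = "lifts G" and ?\<phi> = "\<lambda>t. sqrt (h (cis t))"
  interpret line_action ?L ?\<phi> by (rule lifts_line_action[OF assms(1-3)])
  have bij: "g \<in> Bij circle" if "g \<in> G" for g using that G by (auto simp: Diff2_plus_def)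
  have g_circle: "g x \<in> circle" if "g \<in> G" "x \<in> circle" for g x
    using bij[OF that(1)] that(2) Bij_imp_funcset by blast
  have inj: "inj_on g circle" if "g \<in> G" for g
    using bij[OF that] by (simp add: Bij_def bij_betw_def)
  have lift: "\<exists>F\<in>?L. \<forall>t. cis (F t) = g (cis t)" if g: "g \<in> G" for g
  proof -
    obtain z where "g (cis 0) = cis z" using g_circle[OF g cis_in_circle] circle_cis by blast
    then show ?thesis using lift_exists[OF G g] by metis
  qed
  have D_lift: "D F t = metric_deriv h g (cis t)" if "F \<in> ?L" "\<And>t. cis (F t) = g (cis t)" for F g t
    using DERIV_imp_deriv[OF lifts_deriv[where g = g, OF that]] by (simp add: D_def metric_deriv_def that(2))
  have nonexp_iff: "t \<in> nonexp \<longleftrightarrow> cis t \<in> NE h G" for t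
  proof
    assume t: "t \<in> nonexp"
    have "metric_deriv h g (cis t) \<le> 1" if g: "g \<in> G" for g
      using lift[OF g] t D_lift[of _ g t] unfolding nonexp_def by force
    then show "cis t \<in> NE h G" by (simp add: NE_def)
  next
    assume t: "cis t \<in> NE h G"
    have "D F t \<le> 1" if F: "F \<in> ?L" for F
    proof -
      obtain g where "g \<in> G" "\<And>t. cis (F t) = g (cis t)" using F unfolding lifts_def by blast
      then show ?thesis using t D_lift[OF F, of g t] by (simp add: NE_def)
    qed
    then show "t \<in> nonexp" by (simp add: nonexp_def)
  qed
  interpret star_line_action ?L ?\<phi>
  proof
    fix y assume "y \<in> nonexp"
    then obtain gp gm \<epsilon> where gp: "gp \<in> G" "gp (cis y) = cis y" and gm: "gm \<in> G" "gm (cis y) = cis y"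
      and \<epsilon>: "\<epsilon> > 0" "\<And>t. t \<in> {0<..<\<epsilon>} \<Longrightarrow> gp (cis y * cis t) \<noteq> cis y * cis t"
        "\<And>t. t \<in> {-\<epsilon><..<0} \<Longrightarrow> gm (cis y * cis t) \<noteq> cis y * cis t"
      using assms(5) unfolding nonexp_iff property_star_def by meson
    \<comment> \<open>The lifts are chosen to fix \<open>y\<close> itself, not only modulo the
      period; a further fixed point on the line would project to one on the excluded arc.\<close>
    obtain F where F: "F \<in> ?L" "F y = y" "\<And>t. cis (F t) = gp (cis t)"
      using lift_exists[OF G gp] by metis
    obtain H where H: "H \<in> ?L" "H y = y" "\<And>t. cis (H t) = gm (cis t)"
      using lift_exists[OF G gm] by metis
    have "F t \<noteq> t" if "y < t" "t < y + \<epsilon>" for t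
      using \<epsilon>(2)[of "t - y"] that F(3)[of t] by (auto simp: cis_mult)
    moreover have "H t \<noteq> t" if "y - \<epsilon> < t" "t < y" for t
      using \<epsilon>(3)[of "t - y"] that H(3)[of t] by (auto simp: cis_mult)
    ultimately show "\<exists>F\<in>?L. \<exists>H\<in>?L. \<exists>\<epsilon>>0. F y = y \<and> H y = y \<and>
      (\<forall>t. y < t \<and> t < y + \<epsilon> \<longrightarrow> F t \<noteq> t) \<and> (\<forall>t. y - \<epsilon> < t \<and> t < y \<longrightarrow> H t \<noteq> t)"
      using F(1,2) H(1,2) \<epsilon>(1) by blast
  qed
  have fin: "finite (NE h G)"
  proof (rule finite_subset)
    show "NE h G \<subseteq> cis ` (nonexp \<inter> {0..2 * pi})"
    proof
      fix x assume x: "x \<in> NE h G"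
      then obtain t where t: "x = cis t" using circle_cis by (auto simp: NE_def)
      obtain k :: int where k: "0 \<le> t + 2 * pi * of_int k" "t + 2 * pi * of_int k < 2 * pi"
        by (rule reduce_mod_period)
      have "x = cis (t + 2 * pi * of_int k)" by (simp add: t cis_shift)
      with k x show "x \<in> cis ` (nonexp \<inter> {0..2 * pi})" by (auto simp: nonexp_iff)
    qed
  qed (simp add: finite_nonexp)
  have unbounded: "\<not> bounded {metric_deriv h g x | g. g \<in> G} \<or> (\<exists>y\<in>NE h G. x \<in> orbit_of G y)"
    if x: "x \<in> circle" for x
  proof -
    obtain t where t: "x = cis t" using x circle_cis by blast
    show ?thesis
    proof (cases "\<exists>F\<in>?L. F t \<in> nonexp")
      case True
      then obtain F where F: "F \<in> ?L" "F t \<in> nonexp" by blast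
      \<comment> \<open>The inverse lift exhibits \<open>x\<close> as the image of the
        non-expandable point \<open>cis (F t)\<close>.\<close>
      obtain H where H: "H \<in> ?L" "H (F t) = t" using inverse[OF F(1)] by blast
      obtain g where g: "g \<in> G" "\<And>t. cis (H t) = g (cis t)" using H(1) unfolding lifts_def by blast
      have "x = g (cis (F t))" using g(2)[of "F t"] H(2) t by simp
      then show ?thesis using F(2) g(1) unfolding nonexp_iff orbit_of_def by blast
    next
      case False
      have "\<not> bounded {metric_deriv h g x | g. g \<in> G}"
      proof
        assume "bounded {metric_deriv h g x | g. g \<in> G}"
        then obtain b where b: "\<And>g. g \<in> G \<Longrightarrow> \<bar>metric_deriv h g x\<bar> \<le> b"
          unfolding bounded_iff by auto
        obtain F where F: "F \<in> ?L" "b + 1 \<le> D F t"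
          using unbounded_expansion False by metis
        obtain g where g: "g \<in> G" "\<And>t. cis (F t) = g (cis t)" using F(1) unfolding lifts_def by blast
        show False using b[OF g(1)] F(2) D_lift[OF F(1) g(2), of t] t by simp
      qed
      then show ?thesis ..
    qed
  qed
  have "countable G"
    using assms(4) generate_countable countable_finite unfolding finitely_generated_in_def by metis
  \<comment> \<open>Each injective \<open>g\<close> pulls the finite set \<open>NE h G\<close> back
    to a finite set, so countability of \<open>G\<close> makes the exceptional set countable, hence
    null.\<close>
  have "countable (\<Union>g\<in>G. {x \<in> circle. g x \<in> NE h G})"
  proof (intro countable_UN \<open>countable G\<close> countable_finite)
    fix g assume g: "g \<in> G"
    have "finite (g -` NE h G \<inter> circle)" by (rule finite_vimage_IntI[OF fin inj[OF g]])
    then show "finite {x \<in> circle. g x \<in> NE h G}"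
      by (rule finite_subset[rotated]) auto
  qed
  then have "countable (cis -` (\<Union>g\<in>G. {x \<in> circle. g x \<in> NE h G}))"
    by (rule countable_vimage_cis)
  moreover have "{x. \<exists>F\<in>?L. F x \<in> nonexp} \<subseteq> cis -` (\<Union>g\<in>G. {x \<in> circle. g x \<in> NE h G})"
  proof
    fix t assume "t \<in> {x. \<exists>F\<in>?L. F x \<in> nonexp}"
    then obtain F where F: "F \<in> ?L" "F t \<in> nonexp" by blast
    then obtain g where g: "g \<in> G" "\<And>t. cis (F t) = g (cis t)" unfolding lifts_def by blast
    then have "g (cis t) \<in> NE h G" using F(2) unfolding nonexp_iff by simp
    then show "t \<in> cis -` (\<Union>g\<in>G. {x \<in> circle. g x \<in> NE h G})" using g(1) by auto
  qed
  ultimately have exc: "negligible {x. \<exists>F\<in>?L. F x \<in> nonexp}"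
    by (meson countable_subset countable_imp_null_set_lborel null_sets_completionI negligible_iff_null_sets)
  have dense: "\<forall>x a b. a < b \<longrightarrow> (\<exists>F\<in>?L. a < F x \<and> F x < b)"
  proof (intro allI impI)
    fix x a b :: real assume "a < b"
    \<comment> \<open>Minimality brings the orbit close to \<open>cis m\<close> on the circle; the
      lift is then taken on the branch that lands within half the length of the interval from its
      midpoint.\<close>
    define m where "m = (a + b) / 2"
    have e: "0 < (b - a) / 2" using \<open>a < b\<close> by simp
    obtain \<delta> where \<delta>: "0 < \<delta>"
      "\<And>z. z \<in> circle \<Longrightarrow> dist z (cis m) < \<delta> \<Longrightarrow> \<exists>s. \<bar>s\<bar> < (b - a) / 2 \<and> z = cis (m + s)"
      using circle_near_cis[OF e] by blast
    have "cis m \<in> closure (orbit_of G (cis x))"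
      using assms(5) cis_in_circle unfolding property_star_def minimal_action_def by blast
    then obtain g where g: "g \<in> G" "dist (g (cis x)) (cis m) < \<delta>"
      using \<delta>(1) unfolding closure_approachable orbit_of_def by blast
    then obtain s where s: "\<bar>s\<bar> < (b - a) / 2" "g (cis x) = cis (m + s)"
      using \<delta>(2) g_circle cis_in_circle by meson
    obtain F where F: "F \<in> ?L" "F x = m + s" using lift_exists[OF G g(1) s(2)] by metis
    have "a < m + s" "m + s < b" using s(1) by (auto simp: m_def abs_if field_simps split: if_splits)
    then show "\<exists>F\<in>?L. a < F x \<and> F x < b" using F by (intro bexI[of _ F]) auto
  qed
  have "lebesgue_ergodic G"
    unfolding lebesgue_ergodic_def
  proof (intro ballI impI)
    fix A assume A: "A \<in> sets circle_lebesgue" and inv: "\<forall>g\<in>G. g ` A = A"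
    have Ac: "A \<subseteq> circle" using sets.sets_into_space[OF A] by (simp add: space_circle_lebesgue)
    have "\<forall>F\<in>?L. \<forall>t. F t \<in> cis -` A \<longleftrightarrow> t \<in> cis -` A"
    proof (intro ballI allI)
      fix F t assume "F \<in> ?L"
      then obtain g where g: "g \<in> G" "\<And>t. cis (F t) = g (cis t)" unfolding lifts_def by blast
      have "g (cis t) \<in> g ` A \<longleftrightarrow> cis t \<in> A"
        by (rule inj_on_image_mem_iff[OF inj[OF g(1)] cis_in_circle Ac])
      then show "F t \<in> cis -` A \<longleftrightarrow> t \<in> cis -` A" using inv g by simp
    qed
    from line_ergodic[OF dense exc circle_lebesgue_vimage(1)[OF A] this]
    show "emeasure circle_lebesgue A = 0 \<or> emeasure circle_lebesgue (circle - A) = 0"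
    proof
      assume "negligible (cis -` A)"
      then show ?thesis using circle_lebesgue_vimage(2)[OF A] by blast
    next
      assume "negligible (- (cis -` A))"
      moreover have "- (cis -` A) = cis -` (circle - A)" by auto
      moreover have "circle - A \<in> sets circle_lebesgue"
        using sets.compl_sets[OF A] by (simp add: space_circle_lebesgue)
      ultimately show ?thesis using circle_lebesgue_vimage(2) by metis
    qed
  qed
  with fin unbounded show ?thesis by blast
qed

end
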